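(* Let $n\ge f\ge 1$ be integers. There exists a transitive circle exchange transformation of $n$ subintervals with exactly $f$ flips if and only if $n+f\ge 5$.
   Context: Let $S^1=[0,1]/(0\sim 1)$ with the orientation induced by $[0,1]$, and with Lebesgue measure. Let $I_1,\dots,I_n$ be pairwise disjoint open subintervals of $S^1$ whose closures cover $S^1$. An $n$-CET (circle exchange transformation of $n$ subintervals) is an injective map $T:\bigcup_{i=1}^n I_i\to S^1$ which is an isometry on each $I_i$ and which cannot be continuously extended to a larger open subset of $S^1$ (so $T$ has exactly $n$ discontinuity points). A flip of $T$ is a subinterval $I_i$ on which $T$ reverses orientation; $f$ is the number of flips. The orbit of $p$ is $O(p)=\{T^m(p): m\in\mathbb{Z},\ p\in\mathrm{Dom}(T^m)\}$, and $T$ is transitive if some orbit is dense in $S^1$. *)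

theory Defs
  imports "HOL-Analysis.Analysis"
begin

text \<open>The circle S^1 = [0,1]/(0~1) is modelled as the unit circle in the complex plane,
  via t \<mapsto> cis(2 pi t); its orientation is the counterclockwise one (induced by [0,1]).
  Euclidean (chord) distance on the unit circle is a strictly increasing function of the
  arc-length distance, so the two metrics have the same isometries.\<close>

abbreviation circle :: "complex set" where
  "circle \<equiv> sphere 0 1"

definition circ_arc :: "real \<Rightarrow> real \<Rightarrow> complex set" where
  "circ_arc a b = (\<lambda>t. cis (2 * pi * t)) ` {a<..<b}"

definition is_open_subinterval :: "complex set \<Rightarrow> bool" where
  "is_open_subinterval J \<longleftrightarrow> (\<exists>a b. a < b \<and> b \<le> a + 1 \<and> J = circ_arc a b)"

definition cet_domain :: "nat \<Rightarrow> (nat \<Rightarrow> complex set) \<Rightarrow> complex set" where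
  "cet_domain n I = (\<Union>i<n. I i)"

text \<open>n-CET: T is considered on the domain D = union of the I i (values elsewhere irrelevant).\<close>
definition is_CET :: "nat \<Rightarrow> (nat \<Rightarrow> complex set) \<Rightarrow> (complex \<Rightarrow> complex) \<Rightarrow> bool" where
  "is_CET n I T \<longleftrightarrow>
     (\<forall>i<n. is_open_subinterval (I i)) \<and>
     (\<forall>i<n. \<forall>j<n. i \<noteq> j \<longrightarrow> I i \<inter> I j = {}) \<and>
     (\<Union>i<n. closure (I i)) = circle \<and>
     inj_on T (cet_domain n I) \<and>
     T ` cet_domain n I \<subseteq> circle \<and>
     (\<forall>i<n. \<forall>x\<in>I i. \<forall>y\<in>I i. dist (T x) (T y) = dist x y) \<and>
     \<not> (\<exists>U g. openin (top_of_set circle) U \<and> cet_domain n I \<subset> U \<and>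
            continuous_on U g \<and> g ` U \<subseteq> circle \<and> (\<forall>z\<in>cet_domain n I. g z = T z))"

text \<open>A flip: T reverses orientation on I i, i.e. it is the restriction of a reflection
  z \<mapsto> c * cnj z (|c| = 1) of the circle.\<close>
definition is_flip :: "(complex \<Rightarrow> complex) \<Rightarrow> complex set \<Rightarrow> bool" where
  "is_flip T J \<longleftrightarrow> (\<exists>c. cmod c = 1 \<and> (\<forall>z\<in>J. T z = c * cnj z))"

definition num_flips :: "nat \<Rightarrow> (nat \<Rightarrow> complex set) \<Rightarrow> (complex \<Rightarrow> complex) \<Rightarrow> nat" where
  "num_flips n I T = card {i. i < n \<and> is_flip T (I i)}"

text \<open>Orbit O(p) = { T^m p : m \<in> Z, p \<in> Dom(T^m) } for the partial injective map T on D.\<close>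
definition cet_orbit :: "complex set \<Rightarrow> (complex \<Rightarrow> complex) \<Rightarrow> complex \<Rightarrow> complex set" where
  "cet_orbit D T p =
     {q. \<exists>k. (\<forall>j<k. (T ^^ j) p \<in> D) \<and> q = (T ^^ k) p} \<union>
     {q. \<exists>k. (\<forall>j<k. (T ^^ j) q \<in> D) \<and> (T ^^ k) q = p}"

definition cet_transitive :: "nat \<Rightarrow> (nat \<Rightarrow> complex set) \<Rightarrow> (complex \<Rightarrow> complex) \<Rightarrow> bool" where
  "cet_transitive n I T \<longleftrightarrow>
     (\<exists>p\<in>circle. circle \<subseteq> closure (cet_orbit (cet_domain n I) T p))"

end

theory Submission
  imports Defs "HOL-Analysis.Kronecker_Approximation_Theorem"
begin

text \<open>Obstruction: on a flipped arc \<open>C\<close> the map is a reflection \<open>R\<close>, so \<open>s = R \<circ> T\<close> fixes \<open>C\<close>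
  pointwise. If \<open>n + f \<le> 4\<close>, the few remaining arcs leave \<open>s\<close> no choice but to be an
  involution, and \<open>T = R \<circ> s\<close> is a product of two involutions. An orbit that returns to \<open>C\<close>
  is then reflected and runs backwards, so an orbit meeting \<open>C\<close> three times is periodic.

  Construction: start from the rotation \<open>y \<mapsto> y + 1\<close> of a circle of irrational length and
  permute and reflect finitely many unit intervals in place. The conjugated map is again an
  interval exchange with dense orbits; its flips sit where the orientation changes. Blocks of
  at most five unit intervals (gadgets) with suitable numbers of pieces and flips can be put
  side by side and realize all \<open>(n, f)\<close> with \<open>f < n\<close> and \<open>n + f \<ge> 5\<close>. For \<open>f = n\<close> the remaining
  unflipped interval is doubled and the rotation is made to pass through both copies, each time
  with a flip.\<close>

section \<open>The circle\<close>

text \<open>The circumference \<open>L\<close> stays a parameter: the construction rotates by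
  exactly 1, so the irrationality sits in the length and the basic gadgets have integer endpoints.
  The obstruction uses \<open>L = 1\<close>. Its only cases \<open>(n, f)\<close> are (1,1), (2,1),
  (3,1), (2,2); there injectivity traps the images of the remaining arcs in the complement of
  \<open>C\<close>, and their lengths leave no room to move. In the construction the obstacle is the
  exact count: every endpoint must be a genuine discontinuity. Jumps must survive when gadgets are
  put side by side and when the circle is closed, which is what the end conditions in
  \<open>gadget\<close> provide. Closing up adds one unflipped piece, so \<open>n + f >= 5\<close>
  becomes \<open>n + f >= 4\<close> for gadgets. Adding a (2,0) or (2,2) gadget keeps the parities
  of \<open>n\<close> and \<open>f\<close>, so a few base gadgets suffice. For \<open>f = n\<close>
  the doubling adds three flipped pieces; (4,4) would need a one-piece gadget, which cannot exist:
  slope 1 forces the value 1 at 0 and slope -1 the value \<open>m + 1\<close>, both excluded. It is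
  built by hand.\<close>

definition circ :: "real \<Rightarrow> real \<Rightarrow> complex" where
  "circ L x = cis (2 * pi * (x / L))"

lemma norm_circ [simp]: "cmod (circ L x) = 1"
  by (simp add: circ_def)

lemma circ_add: "circ L (x + y) = circ L x * circ L y"
  by (simp add: circ_def cis_mult add_divide_distrib ring_distribs)

lemma circ_minus: "circ L (- x) = cnj (circ L x)"
  by (simp add: circ_def cis_cnj)

lemma circ_eq_iff:
  assumes "L \<noteq> 0"
  shows "circ L x = circ L y \<longleftrightarrow> (\<exists>k::int. x = y + k * L)"
proof -
  have "circ L x = circ L y \<longleftrightarrow>
      (\<exists>k::int. 2 * pi * (x / L) = 2 * pi * (y / L) + 2 * pi * k)"
    unfolding circ_def complex_eq_iff cis.sel by (metis sin_cos_eq_iff)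
  also have "\<dots> \<longleftrightarrow> (\<exists>k::int. x = y + k * L)"
  proof (rule ex_cong1)
    fix k :: int
    have "2 * pi * (x / L) = 2 * pi * (y / L) + 2 * pi * k \<longleftrightarrow>
        2 * pi * (x / L) = 2 * pi * (y / L + k)"
      by (simp add: ring_distribs)
    also have "\<dots> \<longleftrightarrow> x / L = y / L + k"
      by (subst mult_cancel_left) auto
    also have "\<dots> \<longleftrightarrow> x = y + k * L"
      using assms by (simp add: field_simps)
    finally show "2 * pi * (x / L) = 2 * pi * (y / L) + 2 * pi * k \<longleftrightarrow> x = y + k * L" .
  qed
  finally show ?thesis .
qed

lemma circ_add_period [simp]: "L \<noteq> 0 \<Longrightarrow> circ L (x + of_int k * L) = circ L x"
  by (auto simp: circ_eq_iff)

lemma circ_eqD: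
  assumes "circ L x = circ L y" "\<bar>x - y\<bar> < L"
  shows "x = y"
proof -
  have "L > 0" using assms(2) by linarith
  then obtain k :: int where k: "x = y + k * L"
    using assms(1) circ_eq_iff[of L x y] by auto
  then have "\<bar>real_of_int k\<bar> * L < 1 * L"
    using assms(2) \<open>L > 0\<close> by (simp add: abs_mult)
  then have "\<bar>real_of_int k\<bar> < 1"
    using \<open>L > 0\<close> mult_less_cancel_right_pos by blast
  then have "k = 0" by linarith
  then show ?thesis using k by simp
qed

lemma circ_surj:
  assumes "z \<in> circle" "L > 0"
  obtains x where "a \<le> x" "x < a + L" "circ L x = z"
proof -
  obtain t where t: "z = cis t"
    using assms(1) complex_unimodular_polar[of z] by (metis cis_conv_exp cis.code mem_sphere_0)
  define y where "y = t * L / (2 * pi)"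
  have y: "circ L y = z"
    using assms(2) by (simp add: circ_def y_def t)
  define x where "x = y + of_int (- \<lfloor>(y - a) / L\<rfloor>) * L"
  have "circ L x = z"
    unfolding x_def using assms(2) y by (subst circ_add_period) auto
  moreover have "\<lfloor>(y - a) / L\<rfloor> * L \<le> y - a" "y - a < (\<lfloor>(y - a) / L\<rfloor> + 1) * L"
    using assms(2) floor_divide_lower[of L "y - a"] floor_divide_upper[of L "y - a"] by auto
  ultimately show ?thesis
    using that[of x] unfolding x_def by (simp add: algebra_simps)
qed

lemma continuous_on_circ [continuous_intros]:
  "continuous_on S f \<Longrightarrow> continuous_on S (\<lambda>x. circ L (f x))"
  unfolding circ_def divide_inverse by (intro continuous_intros)

lemma isCont_circ: "isCont (circ L) x"
  using continuous_on_circ[of UNIV "\<lambda>x. x" L]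
  by (simp add: continuous_on_eq_continuous_at)

lemma circ_arc_eq_circ: "circ_arc a b = circ 1 ` {a<..<b}"
  by (auto simp: circ_arc_def circ_def)

lemma circ_image_subinterval:
  assumes "0 < L" "a < b" "b \<le> a + L"
  shows "is_open_subinterval (circ L ` {a<..<b})"
proof -
  have "circ L ` {a<..<b} = circ_arc (a / L) (b / L)"
  proof -
    have "{a / L<..<b / L} = (\<lambda>x. x / L) ` {a<..<b}"
      using assms
      by (auto simp: divide_strict_right_mono image_iff field_simps intro!: bexI[of _ "_ * L"])
    then show ?thesis
      by (auto simp: circ_arc_def circ_def image_image)
  qed
  moreover have "a / L < b / L" "b / L \<le> a / L + 1"
    using assms by (auto simp: divide_simps)
  ultimately show ?thesis
    unfolding is_open_subinterval_def by blast
qed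

lemma closure_circ_image:
  assumes "a < b"
  shows "closure (circ L ` {a<..<b}) = circ L ` {a..b}"
proof (rule closure_unique)
  show "circ L ` {a<..<b} \<subseteq> circ L ` {a..b}" by auto
  have "compact (circ L ` {a..b})"
    by (intro compact_continuous_image continuous_intros) auto
  then show "closed (circ L ` {a..b})" by (rule compact_imp_closed)
  fix S assume S: "circ L ` {a<..<b} \<subseteq> S" "closed S"
  have "circ L ` closure {a<..<b} \<subseteq> S"
    by (rule image_closure_subset) (use S in \<open>auto intro: continuous_intros\<close>)
  then show "circ L ` {a..b} \<subseteq> S"
    using assms by simp
qed

lemma infinite_circ_image:
  assumes "0 < L" "a < b"
  shows "infinite (circ L ` {a<..<b})"
proof -
  \<comment> \<open>\<open>b - a\<close> may exceed \<open>L\<close>, so the interval is first cut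
    to at most one period.\<close>
  have inj: "inj_on (circ L) {a<..<min b (a + L)}"
    by (rule inj_onI, erule circ_eqD) auto
  have "infinite (circ L ` {a<..<min b (a + L)})"
    using finite_image_iff[OF inj] assms by simp
  then show ?thesis
    by (rule contrapos_nn) (erule finite_subset[rotated], auto)
qed

text \<open>The complement is the image of the compact interval \<open>{b..a + L}\<close>, hence
  closed; for \<open>b = a + L\<close> it is a single point.\<close>

lemma openin_circ_image:
  assumes "0 < L" "a < b" "b \<le> a + L"
  shows "openin (top_of_set circle) (circ L ` {a<..<b})"
proof -
  have "circle - circ L ` {a<..<b} = circ L ` {b..a + L}"
  proof (intro subset_antisym subsetI)
    fix z assume z: "z \<in> circle - circ L ` {a<..<b}"
    obtain x where x: "a \<le> x" "x < a + L" "circ L x = z"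
      using circ_surj[of z L a] z assms by blast
    have "circ L (x + L) = z"
      using circ_add_period[of L x 1] x assms by simp
    moreover have "x = a \<or> b \<le> x" using x z by force
    \<comment> \<open>The representative found in \<open>[a, a + L)\<close> may be \<open>a\<close>
      itself, which has to be moved to the other end \<open>a + L\<close>.\<close>
    ultimately have "circ L (if x = a then x + L else x) = z"
        "(if x = a then x + L else x) \<in> {b..a + L}"
      using x assms by auto
    then show "z \<in> circ L ` {b..a + L}" by blast
  next
    fix z assume "z \<in> circ L ` {b..a + L}"
    then obtain x where x: "b \<le> x" "x \<le> a + L" "z = circ L x" by auto
    have "circ L x \<noteq> circ L y" if "a < y" "y < b" for y
      using circ_eqD[of L x y] that x by force
    then have "circ L x \<notin> circ L ` {a<..<b}" by (metis imageE greaterThanLessThan_iff)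
    then show "z \<in> circle - circ L ` {a<..<b}" using x by simp
  qed
  moreover have "closed (circ L ` {b..a + L})"
    by (intro compact_imp_closed compact_continuous_image continuous_intros) auto
  ultimately have "closedin (top_of_set circle) (circle - circ L ` {a<..<b})"
    by (metis Diff_subset closed_subset)
  moreover have "circ L ` {a<..<b} \<subseteq> circle" by auto
  ultimately show ?thesis
    by (simp add: openin_closedin_eq)
qed

lemma infinite_circle: "infinite circle"
proof
  assume "finite circle"
  moreover have "circ 1 ` {0<..<1} \<subseteq> circle" by auto
  ultimately show False
    using infinite_circ_image[of 1 0 1] finite_subset by auto
qed

section \<open>Isometries between subsets of the circle\<close>

text \<open>For unit \<open>u\<close> the squared distance to 1 is \<open>2 - 2 * Re u\<close>, so
  the distance determines the real part, and the unit norm determines the imaginary part up to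
  sign.\<close>

lemma circle_dist_eqD:
  assumes "cmod w = 1" "cmod z = 1" "cmod (w - 1) = cmod (z - 1)"
  shows "w = z \<or> w = cnj z"
proof -
  have n: "(cmod (u - 1))\<^sup>2 = 2 - 2 * Re u" if "cmod u = 1" for u
  proof -
    have "(Re u)\<^sup>2 + (Im u)\<^sup>2 = 1" using cmod_power2[of u] that by simp
    then show ?thesis
      unfolding cmod_power2 by (simp add: power2_eq_square algebra_simps)
  qed
  have "Re w = Re z"
    using n[OF assms(1)] n[OF assms(2)] assms(3) by simp
  moreover have "(Im w)\<^sup>2 = (Im z)\<^sup>2"
    using assms(1,2) calculation unfolding norm_complex_def by simp
  ultimately show ?thesis
    by (auto simp: complex_eq_iff power2_eq_iff)
qed

text \<open>Dividing by a base point \<open>p\<close> and by its image reduces to isometries that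
  fix 1, which by \<open>circle_dist_eqD\<close> are the identity or conjugation at each point. The
  choice is uniform because two non-real points treated differently would change their
  distance.\<close>

lemma circle_isometry_cases:
  assumes J: "J \<subseteq> circle" and T: "T ` J \<subseteq> circle"
    and iso: "\<And>x y. x \<in> J \<Longrightarrow> y \<in> J \<Longrightarrow> dist (T x) (T y) = dist x y"
  shows "(\<exists>c. cmod c = 1 \<and> (\<forall>z\<in>J. T z = c * z)) \<or> is_flip T J"
proof (cases "J = {}")
  case True
  then show ?thesis by (auto intro: exI[of _ 1])
next
  case False
  then obtain p where p: "p \<in> J" by blast
  have np: "cmod p = 1" "cmod (T p) = 1" using p J T by auto
  then have p0: "p \<noteq> 0" "T p \<noteq> 0" by auto
  define w where "w z = T z / T p" for z
  define u where "u z = z / p" for z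
  have nw: "cmod (w z) = 1" "cmod (u z) = 1" if "z \<in> J" for z
    using that J T np by (auto simp: w_def u_def norm_divide)
  have d: "cmod (w x - w y) = cmod (u x - u y)" if "x \<in> J" "y \<in> J" for x y
    using iso[OF that] np
    by (simp add: w_def u_def dist_norm flip: diff_divide_distrib) (simp add: norm_divide)
  have w1: "w p = 1" "u p = 1" using p0 by (auto simp: w_def u_def)
  have wc: "w z = u z \<or> w z = cnj (u z)" if "z \<in> J" for z
    using circle_dist_eqD[OF nw[OF that]] d[OF that p] w1 by simp
  have "(\<forall>z\<in>J. w z = u z) \<or> (\<forall>z\<in>J. w z = cnj (u z))"
  proof (rule ccontr)
    assume "\<not> ?thesis"
    then obtain x y where xy: "x \<in> J" "y \<in> J" "w x \<noteq> u x" "w y \<noteq> cnj (u y)" by blast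
    then have wx: "w x = cnj (u x)" and wy: "w y = u y" using wc by auto
    have "Im (u x) \<noteq> 0" "Im (u y) \<noteq> 0"
      using xy wx wy by (auto simp: complex_eq_iff)
    moreover have "(cmod (cnj (u x) - u y))\<^sup>2 = (cmod (u x - u y))\<^sup>2"
      using d[OF xy(1,2)] wx wy by simp
    \<comment> \<open>The two squared distances differ by
      \<open>4 * Im (u x) * Im (u y)\<close>.\<close>
    then have "Im (u x) * Im (u y) = 0"
      unfolding cmod_power2 by (simp add: power2_eq_square algebra_simps)
    ultimately show False by simp
  qed
  then show ?thesis
  proof
    assume *: "\<forall>z\<in>J. w z = u z"
    have "T z = T p / p * z" if "z \<in> J" for z
      using *[rule_format, OF that] p0 by (simp add: w_def u_def field_simps)
    then show ?thesis
      using np by (intro disjI1 exI[of _ "T p / p"]) (auto simp: norm_divide)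
  next
    assume *: "\<forall>z\<in>J. w z = cnj (u z)"
    have "T z = T p * p * cnj z" if "z \<in> J" for z
    proof -
      have "cnj (z / p) = p * cnj z"
        using np(1) by (simp add: divide_conv_cnj mult.commute)
      then have "T z / T p = p * cnj z"
        using *[rule_format, OF that] by (simp add: w_def u_def)
      then show ?thesis
        using p0 by (simp add: divide_eq_eq mult_ac)
    qed
    then show ?thesis
      using np by (intro disjI2) (auto simp: is_flip_def norm_mult intro!: exI[of _ "T p * p"])
  qed
qed

section \<open>Orbits of partial injections\<close>

text \<open>One relation for both halves of \<open>cet_orbit\<close>: negative powers become paths
  into \<open>p\<close>, with no inverse map. The last point \<open>y\<close> need not lie in
  \<open>D\<close>.\<close>

definition reaches :: "'a set \<Rightarrow> ('a \<Rightarrow> 'a) \<Rightarrow> nat \<Rightarrow> 'a \<Rightarrow> 'a \<Rightarrow> bool" where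
  "reaches D T k x y \<longleftrightarrow> (\<forall>j<k. (T ^^ j) x \<in> D) \<and> (T ^^ k) x = y"

lemma cet_orbit_eq:
  "cet_orbit D T p = {q. \<exists>k. reaches D T k p q} \<union> {q. \<exists>k. reaches D T k q p}"
  unfolding cet_orbit_def reaches_def by auto

lemma reaches_0 [simp]: "reaches D T 0 x y \<longleftrightarrow> x = y"
  by (simp add: reaches_def)

lemma reaches_Suc: "reaches D T (Suc k) x y \<longleftrightarrow> x \<in> D \<and> reaches D T k (T x) y"
  unfolding reaches_def by (auto simp: funpow_swap1 less_Suc_eq_0_disj simp del: funpow.simps(2))
    (auto simp: funpow_Suc_right simp del: funpow.simps(2))

lemma reaches_add: "reaches D T k x y \<Longrightarrow> reaches D T l y z \<Longrightarrow> reaches D T (k + l) x z"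
  by (induction k arbitrary: x) (auto simp: reaches_Suc)

lemma reaches_split: "reaches D T (k + l) x z \<Longrightarrow> \<exists>y. reaches D T k x y \<and> reaches D T l y z"
  by (induction k arbitrary: x) (auto simp: reaches_Suc)

text \<open>Injectivity identifies predecessors, so the common final \<open>k\<close> steps of two
  paths can be cancelled one by one.\<close>

lemma reaches_inj:
  assumes "inj_on T D" "reaches D T k x z" "reaches D T (k + l) y z"
  shows "reaches D T l y x"
  using assms(2,3)
proof (induction k arbitrary: z)
  case (Suc k)
  have "reaches D T (k + 1) x z" using Suc.prems by simp
  then obtain x' where x': "reaches D T k x x'" "x' \<in> D" "T x' = z"
    using reaches_split[of D T k 1] by (auto simp: reaches_Suc)
  have "reaches D T ((k + l) + 1) y z" using Suc.prems by simp
  then obtain y' where y': "reaches D T (k + l) y y'" "y' \<in> D" "T y' = z"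
    using reaches_split[of D T "k + l" 1] by (auto simp: reaches_Suc)
  have "x' = y'" using x' y' assms(1) by (metis inj_onD)
  then show ?case using Suc.IH x' y' by blast
qed simp

text \<open>Two points after \<open>p\<close> are compared by splitting the longer path, two points
  before \<open>p\<close> by \<open>reaches_inj\<close>, and a mixed pair by passing through
  \<open>p\<close>.\<close>

lemma orbit_comparable:
  assumes inj: "inj_on T D" and x: "x \<in> cet_orbit D T p" and y: "y \<in> cet_orbit D T p"
  shows "\<exists>k. reaches D T k x y \<or> reaches D T k y x"
proof -
  have fwd: "\<exists>k. reaches D T k x y \<or> reaches D T k y x"
    if kl: "reaches D T k p x" "reaches D T l p y" "k \<le> l" for k l x y
  proof -
    obtain x' where "reaches D T k p x'" "reaches D T (l - k) x' y"
      using reaches_split[of D T k "l - k" p y] kl by auto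
    then show ?thesis using kl(1) by (auto simp: reaches_def)
  qed
  have bwd: "\<exists>k. reaches D T k x y \<or> reaches D T k y x"
    if "reaches D T k x p" "reaches D T l y p" "k \<le> l" for k l x y
    using reaches_inj[OF inj that(1), of "l - k" y] that by auto
  from x y show ?thesis
    unfolding cet_orbit_eq Un_iff mem_Collect_eq
  proof (elim disjE exE)
    fix k l
    assume "reaches D T k p x" "reaches D T l p y"
    then show ?thesis using fwd by (meson linear)
  next
    fix k l
    assume "reaches D T k x p" "reaches D T l y p"
    then show ?thesis using bwd by (meson linear)
  qed (metis reaches_add)+
qed

lemma periodic_orbit_finite:
  assumes inj: "inj_on T D" and q: "q \<in> cet_orbit D T p" and per: "reaches D T r q q" and "r \<noteq> 0"
  shows "finite (cet_orbit D T p)"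
proof -
  define P where "P = (\<lambda>j. (T ^^ j) q) ` {..<r}"
  have PD: "P \<subseteq> D" using per by (auto simp: P_def reaches_def)
  have qP: "q \<in> P" unfolding P_def using \<open>r \<noteq> 0\<close> by (intro image_eqI[of _ _ 0]) auto
  have img: "T ` P = P"
  proof (intro subset_antisym subsetI)
    fix z assume "z \<in> T ` P"
    then obtain j where j: "j < r" "z = (T ^^ Suc j) q" by (auto simp: P_def)
    show "z \<in> P"
      using j per qP by (cases "Suc j = r") (auto simp: P_def reaches_def simp del: funpow.simps)
  next
    fix z assume "z \<in> P"
    then obtain j where j: "j < r" "z = (T ^^ j) q" by (auto simp: P_def)
    \<comment> \<open>The predecessor of the starting point of the cycle is its last point, of index
      \<open>r - 1\<close>.\<close>
    then have "z = (T ^^ Suc (if j = 0 then r - 1 else j - 1)) q"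
      using per \<open>r \<noteq> 0\<close> by (auto simp: reaches_def simp del: funpow.simps)
    then show "z \<in> T ` P"
      using j \<open>r \<noteq> 0\<close> unfolding P_def
      by (intro image_eqI[of _ _ "(T ^^ (if j = 0 then r - 1 else j - 1)) q"]) auto
  qed
  have fwd: "y \<in> P" if "reaches D T k x y" "x \<in> P" for k x y
    using that
  proof (induction k arbitrary: x)
    case (Suc k)
    then have "T x \<in> P" using img by blast
    then show ?case using Suc by (auto simp: reaches_Suc)
  qed auto
  have bwd: "x \<in> P" if "reaches D T k x y" "y \<in> P" for k x y
    using that
  proof (induction k arbitrary: x)
    case (Suc k)
    then have x: "x \<in> D" "T x \<in> P" by (auto simp: reaches_Suc)
    then obtain x' where "x' \<in> P" "T x' = T x" using img by (metis imageE)
    then show ?case using x PD inj by (metis inj_onD subsetD)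
  qed auto
  have "p \<in> P"
    using q fwd bwd qP unfolding cet_orbit_eq by auto
  then have "cet_orbit D T p \<subseteq> P"
    using fwd bwd unfolding cet_orbit_eq by auto
  then show ?thesis
    by (rule finite_subset) (simp add: P_def)
qed

section \<open>Few arcs: no dense orbit\<close>

text \<open>Since \<open>s\<close> fixes \<open>b = z k\<close>, the orbit is mirrored there:
  \<open>z (k + i) = s (z (k - i))\<close>. If \<open>k <= m\<close>, the mirrored orbit gets back
  to \<open>a\<close> after \<open>2 * k\<close> steps. Otherwise it first meets \<open>c\<close>;
  as \<open>s c = c\<close>, injectivity of \<open>s\<close> gives \<open>c = z (k - m)\<close>, so
  \<open>c\<close> recurs after \<open>2 * m\<close> steps.\<close>

lemma reflection_return_periodic:
  assumes R: "\<And>z. R (R z) = z" and T: "\<And>z. z \<in> D \<Longrightarrow> T z = R (s z)"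
    and inv: "\<And>z. z \<in> D \<Longrightarrow> s z \<in> D \<Longrightarrow> s (s z) = z"
    and s_inj: "inj_on s D" and CD: "C \<subseteq> D" and C: "\<And>z. z \<in> C \<Longrightarrow> s z = z"
    and abc: "a \<in> C" "b \<in> C" "c \<in> C" and ab: "reaches D T k a b" and bc: "reaches D T m b c"
    and km: "k \<noteq> 0" "m \<noteq> 0"
  shows "\<exists>r q. r \<noteq> 0 \<and> (q = a \<or> q = c) \<and> reaches D T r q q"
proof -
  define z where "z j = (T ^^ j) a" for j
  have ac: "reaches D T (k + m) a c" using reaches_add[OF ab bc] .
  have zD: "z j \<in> D" if "j \<le> k + m" for j
    using that ac abc CD by (cases "j = k + m") (auto simp: reaches_def z_def)
  have zS: "z (Suc j) = R (s (z j))" if "j \<le> k + m" for j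
    using T[OF zD[OF that]] by (simp add: z_def)
  have mirror: "z (k + i) = s (z (k - i))" if "i \<le> k" "i \<le> m" for i
    using that
  proof (induction i)
    case 0
    then show ?case using ab abc(2) C by (simp add: z_def reaches_def)
  next
    case (Suc i)
    then have IH: "z (k + i) = s (z (k - i))" by simp
    have "z (k + Suc i) = R (s (s (z (k - i))))"
      using zS[of "k + i"] Suc.prems IH by simp
    also have "s (s (z (k - i))) = z (k - i)"
      using zD[of "k - i"] zD[of "k + i"] IH Suc.prems by (intro inv) auto
    also have "z (k - i) = R (s (z (k - Suc i)))"
      using zS[of "k - Suc i"] Suc.prems by (simp add: Suc_diff_Suc)
    finally show ?case using R by simp
  qed
  show ?thesis
  proof (cases "k \<le> m")
    case True
    then have "z (k + k) = a"
      using mirror[of k] abc(1) C by (simp add: z_def)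
    then have "reaches D T (k + k) a a"
      using zD True by (auto simp: reaches_def z_def)
    then show ?thesis using km by (intro exI[of _ "k + k"] exI[of _ a]) auto
  next
    case False
    have "s c = s (z (k - m))"
      using mirror[of m] False ac abc(3) C by (simp add: reaches_def z_def)
    then have c: "c = z (k - m)"
      using s_inj abc(3) CD zD[of "k - m"] by (auto dest: inj_onD)
    obtain y where y: "reaches D T (k - m) a y" "reaches D T (2 * m) y c"
      using reaches_split[of D T "k - m" "2 * m" a c] ac False
      by (metis add.assoc le_add_diff_inverse2 mult_2 nle_le)
    then have "y = c" using c by (simp add: reaches_def z_def)
    then show ?thesis using y km by (intro exI[of _ "2 * m"] exI[of _ c]) auto
  qed
qed

text \<open>A dense orbit meets the open set \<open>C\<close> infinitely often; three of these
  points in orbit order supply the two returns of \<open>reflection_return_periodic\<close>, and a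
  periodic orbit is finite.\<close>

lemma not_dense_of_reflection:
  assumes D: "D \<subseteq> circle" and TD: "T ` D \<subseteq> circle" and p: "p \<in> circle"
    and T_inj: "inj_on T D" and R: "\<And>z. R (R z) = z" and T: "\<And>z. z \<in> D \<Longrightarrow> T z = R (s z)"
    and inv: "\<And>z. z \<in> D \<Longrightarrow> s z \<in> D \<Longrightarrow> s (s z) = z"
    and s_inj: "inj_on s D" and CD: "C \<subseteq> D" and C: "\<And>z. z \<in> C \<Longrightarrow> s z = z"
    and C_open: "openin (top_of_set circle) C" and C_inf: "infinite C"
  shows "\<not> circle \<subseteq> closure (cet_orbit D T p)"
proof
  assume dense: "circle \<subseteq> closure (cet_orbit D T p)"
  define Orb where "Orb = cet_orbit D T p"
  have fwd: "y \<in> circle" if "reaches D T k x y" "x \<in> circle" for k x y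
    using that
  proof (induction k arbitrary: x)
    case (Suc k)
    then have "x \<in> D" "reaches D T k (T x) y" by (auto simp: reaches_Suc)
    then show ?case using Suc.IH TD by blast
  qed simp
  have bwd: "x \<in> circle" if "reaches D T k x y" "y \<in> circle" for k x y
  proof (cases k)
    case (Suc l)
    then have "x \<in> D" using that by (simp add: reaches_Suc)
    then show ?thesis using D by blast
  qed (use that in simp)
  have Orb: "Orb \<subseteq> circle"
    using fwd[OF _ p] bwd[OF _ p] unfolding Orb_def cet_orbit_eq by blast
  have inf: "infinite Orb"
    using dense infinite_circle unfolding Orb_def
    by (metis closure_closed finite_imp_closed finite_subset)
  \<comment> \<open>Otherwise removing finitely many orbit points from \<open>C\<close> leaves a
    nonempty open set that the orbit misses.\<close>
  have "infinite (Orb \<inter> C)"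
  proof
    assume fin: "finite (Orb \<inter> C)"
    have "closedin (top_of_set circle) (Orb \<inter> C)"
      using finite_imp_closed[OF fin] Orb by (intro closed_subset) auto
    then have "openin (top_of_set circle) (C - (Orb \<inter> C))"
      by (rule openin_diff[OF C_open])
    then obtain U where U: "open U" "C - (Orb \<inter> C) = circle \<inter> U"
      by (auto simp: openin_open)
    have "C - (Orb \<inter> C) \<noteq> {}"
      using fin C_inf by (metis Diff_eq_empty_iff finite_subset)
    then obtain z where z: "z \<in> circle" "z \<in> U" using U by blast
    then have "z \<in> closure Orb" using dense Orb_def by blast
    then obtain w where "w \<in> Orb" "w \<in> U"
      using open_Int_closure_eq_empty[OF U(1), of Orb] z(2) by blast
    then show False using U(2) Orb by blast
  qed
  then obtain S where S: "S \<subseteq> Orb \<inter> C" "card S = 3"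
    using infinite_arbitrarily_large by blast
  define le where "le x y \<longleftrightarrow> (\<exists>k. reaches D T k x y)" for x y
  have total: "le x y \<or> le y x" if "x \<in> S" "y \<in> S" for x y
    using orbit_comparable[OF T_inj, of x p y] S(1) that by (auto simp: le_def Orb_def)
  obtain u v w where uvw: "S = {u, v, w}" "u \<noteq> v" "v \<noteq> w" "u \<noteq> w"
    using S(2) by (auto simp: card_3_iff)
  \<comment> \<open>Totality alone yields the chain: a tournament on three points has a Hamiltonian
    path.\<close>
  have sorted: "\<exists>a b c. {a, b, c} \<subseteq> S \<and> a \<noteq> b \<and> b \<noteq> c \<and> le a b \<and> le b c"
  proof -
    have "le u v \<or> le v u" "le v w \<or> le w v" "le u w \<or> le w u"
      using total uvw(1) by auto
    moreover have ?thesis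
      if "le a b" "le b c" "a \<noteq> b" "b \<noteq> c" "a \<in> S" "b \<in> S" "c \<in> S" for a b c
      using that by blast
    moreover have "u \<in> S" "v \<in> S" "w \<in> S" using uvw(1) by auto
    ultimately show ?thesis
      using uvw(2-4) by (elim disjE) metis+
  qed
  then obtain a b c where abc: "{a, b, c} \<subseteq> S" "a \<noteq> b" "b \<noteq> c" "le a b" "le b c"
    by blast
  obtain k m where km: "reaches D T k a b" "reaches D T m b c"
    using abc by (auto simp: le_def)
  have k0: "k \<noteq> 0" and m0: "m \<noteq> 0"
    using km abc(2,3) by (metis reaches_0)+
  have in_C: "a \<in> C" "b \<in> C" "c \<in> C" and in_Orb: "a \<in> Orb" "c \<in> Orb"
    using abc(1) S(1) by blast+
  have "\<exists>r q. r \<noteq> 0 \<and> (q = a \<or> q = c) \<and> reaches D T r q q"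
    by (rule reflection_return_periodic[where R = R and s = s and C = C and b = b and k = k and m = m])
      (fact R T inv s_inj CD C in_C km k0 m0)+
  then obtain r q where "r \<noteq> 0" "q \<in> Orb" "reaches D T r q q"
    using in_Orb by metis
  then have "finite Orb"
    using periodic_orbit_finite[OF T_inj, of q p r] by (simp add: Orb_def)
  then show False using inf by simp
qed

section \<open>Arcs confined to the complement of a given arc\<close>

text \<open>The interval \<open>[c1, c0 + 1]\<close> is a chart for the complement of the arc from
  \<open>c0\<close> to \<open>c1\<close>. With \<open>p + k\<close> chosen in
  \<open>[c0, c0 + 1)\<close>, a lift that sticks out of the chart would overlap a translate of
  \<open>(c0, c1)\<close>.\<close>

lemma arc_lift:
  assumes disj: "circ 1 ` {p<..<q} \<inter> circ 1 ` {c0<..<c1} = {}" and pq: "p < q" "c0 < c1"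
  obtains k :: int where "c1 \<le> p + k" "q + k \<le> c0 + 1"
proof -
  define k :: int where "k = - \<lfloor>p - c0\<rfloor>"
  have k: "c0 \<le> p + k" "p + k < c0 + 1"
    unfolding k_def by linarith+
  have no: False if "x \<in> {p<..<q}" "y \<in> {c0<..<c1}" "x = y + of_int l" for x y l
  proof -
    have "circ 1 x = circ 1 y" using circ_add_period[of 1 y l] that(3) by simp
    then have "circ 1 x \<in> circ 1 ` {p<..<q} \<inter> circ 1 ` {c0<..<c1}"
      using that(1,2) by (metis IntI imageI)
    then show False using disj by simp
  qed
  have "c1 \<le> p + k"
  proof (rule ccontr)
    assume "\<not> ?thesis"
    then have "p + k < min c1 (q + k)" using pq by simp
    then obtain x where "p + k < x" "x < min c1 (q + k)" using dense by blast
    then have "x - k \<in> {p<..<q}" "x \<in> {c0<..<c1}"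
      using k by auto
    from no[OF this, of "- k"] show False by simp
  qed
  moreover have "q + k \<le> c0 + 1"
  proof (rule ccontr)
    assume "\<not> ?thesis"
    then have "c0 + 1 < min (c1 + 1) (q + k)" using pq by simp
    then obtain x where "c0 + 1 < x" "x < min (c1 + 1) (q + k)" using dense by blast
    then have "x - k \<in> {p<..<q}" "x - 1 \<in> {c0<..<c1}"
      using k by auto
    from no[OF this, of "1 - k"] show False by simp
  qed
  ultimately show ?thesis by (rule that)
qed

lemma circ_shift_image:
  assumes "cmod \<alpha> = 1" "circ 1 t = \<alpha>"
  shows "(\<lambda>z. \<alpha> * z) ` circ 1 ` {p<..<q} = circ 1 ` {p + t<..<q + t}"
    and "(\<lambda>z. \<alpha> * cnj z) ` circ 1 ` {p<..<q} = circ 1 ` {t - q<..<t - p}"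
proof -
  have "{p + t<..<q + t} = (\<lambda>x. t + x) ` {p<..<q}"
    by (auto simp: image_iff intro!: bexI[of _ "_ - t"])
  then show "(\<lambda>z. \<alpha> * z) ` circ 1 ` {p<..<q} = circ 1 ` {p + t<..<q + t}"
    using assms by (simp add: image_image circ_add)
  have "{t - q<..<t - p} = (\<lambda>x. t + - x) ` {p<..<q}"
    by (auto simp: image_iff intro!: bexI[of _ "t - _"])
  then show "(\<lambda>z. \<alpha> * cnj z) ` circ 1 ` {p<..<q} = circ 1 ` {t - q<..<t - p}"
    using assms by (simp only: image_image circ_add circ_minus)
qed

text \<open>The rotated arc is as long as the complement that has to contain it, so its lift is
  translated by an integer.\<close>

lemma rotation_of_complementary_arc:
  assumes "cmod \<alpha> = 1" and cc: "c0 < c1" "c1 < c0 + 1"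
    and disj: "(\<lambda>z. \<alpha> * z) ` circ 1 ` {c1<..<c0 + 1} \<inter> circ 1 ` {c0<..<c1} = {}"
  shows "\<alpha> = 1"
proof -
  obtain t where t: "circ 1 t = \<alpha>" using circ_surj[of \<alpha> 1 0] assms(1) by auto
  obtain k :: int where k: "c1 \<le> c1 + t + k" "c0 + 1 + t + k \<le> c0 + 1"
    using disj arc_lift[of "c1 + t" "c0 + 1 + t" c0 c1] cc
    unfolding circ_shift_image(1)[OF assms(1) t] by auto
  then have "t = 0 + of_int (- k) * 1" by simp
  then show ?thesis using t circ_add_period[of 1 0 "- k"] by (simp add: circ_def)
qed

text \<open>The two image intervals are disjoint, lie in \<open>[c1, c0 + 1]\<close> and have its
  total length, so they tile it. In the original order each arc is reflected in place; in the
  opposite order both reflections are \<open>x\<close> to \<open>c0 + 1 + c1 - x\<close>, the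
  reflection of the whole complement.\<close>

lemma reflections_of_complementary_arcs:
  assumes n: "cmod \<alpha> = 1" "cmod \<beta> = 1" and cc: "c0 < c1" "c1 < m" "m < c0 + 1"
    and A: "A = circ 1 ` {c1<..<m}" and B: "B = circ 1 ` {m<..<c0 + 1}"
    and C: "C = circ 1 ` {c0<..<c1}"
    and disj: "(\<lambda>z. \<alpha> * cnj z) ` A \<inter> C = {}" "(\<lambda>z. \<beta> * cnj z) ` B \<inter> C = {}"
      "(\<lambda>z. \<alpha> * cnj z) ` A \<inter> (\<lambda>z. \<beta> * cnj z) ` B = {}"
  shows "(\<lambda>z. \<alpha> * cnj z) ` A = A \<and> (\<lambda>z. \<beta> * cnj z) ` B = B \<or> \<alpha> = \<beta>"
proof -
  obtain t0 where t0: "circ 1 t0 = \<alpha>" using circ_surj[of \<alpha> 1 0] n(1) by auto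
  have "circ 1 ` {t0 - m<..<t0 - c1} \<inter> circ 1 ` {c0<..<c1} = {}"
    using disj(1) unfolding A C circ_shift_image(2)[OF n(1) t0] .
  from arc_lift[OF this] cc
  obtain k :: int where k: "c1 \<le> t0 - m + k" "t0 - c1 + k \<le> c0 + 1"
    by (metis diff_strict_left_mono)
  define t where "t = t0 + k"
  have t: "circ 1 t = \<alpha>" using t0 circ_add_period[of 1 t0 k] by (simp add: t_def)
  obtain r0 where r0: "circ 1 r0 = \<beta>" using circ_surj[of \<beta> 1 0] n(2) by auto
  have "circ 1 ` {r0 - (c0 + 1)<..<r0 - m} \<inter> circ 1 ` {c0<..<c1} = {}"
    using disj(2) unfolding B C circ_shift_image(2)[OF n(2) r0] .
  from arc_lift[OF this] cc
  obtain l :: int where l: "c1 \<le> r0 - (c0 + 1) + l" "r0 - m + l \<le> c0 + 1"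
    by (metis diff_strict_left_mono)
  define r where "r = r0 + l"
  have r: "circ 1 r = \<beta>" using r0 circ_add_period[of 1 r0 l] by (simp add: r_def)
  have "circ 1 ` {t - m<..<t - c1} \<inter> circ 1 ` {r - (c0 + 1)<..<r - m} = {}"
    using disj(3) unfolding A B circ_shift_image(2)[OF n(1) t] circ_shift_image(2)[OF n(2) r] .
  then have "\<not> (x \<in> {t - m<..<t - c1} \<and> x \<in> {r - (c0 + 1)<..<r - m})" for x
    by blast
  then have "\<not> max (t - m) (r - (c0 + 1)) < min (t - c1) (r - m)"
    by (meson dense greaterThanLessThan_iff max_less_iff_conj min_less_iff_conj)
  then have "t - c1 \<le> r - (c0 + 1) \<or> r - m \<le> t - m"
    using cc by (auto simp: min_def max_def split: if_splits)
  then show ?thesis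
  proof
    assume "t - c1 \<le> r - (c0 + 1)"
    then have "t = c1 + m" "r = m + (c0 + 1)" using k l by (auto simp: t_def r_def)
    then show ?thesis
      unfolding A B circ_shift_image(2)[OF n(1) t] circ_shift_image(2)[OF n(2) r] by simp
  next
    assume "r - m \<le> t - m"
    then have "t = r" using k l by (auto simp: t_def r_def)
    then show ?thesis using t r by simp
  qed
qed

lemma mem_of_circ_mem:
  assumes "circ 1 x \<in> circ 1 ` {p..q}" "u < x" "x < u + 1" "u \<le> p" "q \<le> u + 1"
  shows "x \<in> {p..q}"
proof -
  obtain y where y: "y \<in> {p..q}" "circ 1 x = circ 1 y" using assms(1) by auto
  then have "x = y" by (intro circ_eqD[of 1]) (use assms in auto)
  then show ?thesis using y by simp
qed

lemma circ_image_shift_int: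
  "circ 1 ` {p + of_int k<..<q + of_int k} = circ 1 ` {p<..<q}"
proof -
  have "circ 1 (of_int k) = 1"
    using circ_add_period[of 1 0 k] by (simp add: circ_def)
  then show ?thesis
    using circ_shift_image(1)[of 1 "of_int k" p q] by simp
qed

text \<open>Turns a covering of the window \<open>(u, v)\<close> by closed intervals into
  inequalities between their endpoints.\<close>

lemma no_gap:
  fixes u :: real
  assumes "\<And>x. u < x \<Longrightarrow> x < v \<Longrightarrow> \<not> (l < x \<and> x < r)" "u \<le> l" "r \<le> v"
  shows "r \<le> l"
  using assms dense[of l r] by (meson not_le le_less_trans less_le_trans)

lemma few_pieces_not_transitive:
  assumes CET: "is_CET n I T" and f: "1 \<le> num_flips n I T" and nf: "n + num_flips n I T \<le> 4"
  shows "\<not> cet_transitive n I T"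
proof -
  define D where "D = cet_domain n I"
  define F where "F = {i. i < n \<and> is_flip T (I i)}"
  note cet = CET[unfolded is_CET_def, folded D_def]
  note cet1 = cet[THEN conjunct1] and cet2 = cet[THEN conjunct2, THEN conjunct1]
    and cet3 = cet[THEN conjunct2, THEN conjunct2]
  have subint: "\<exists>a b. a < b \<and> b \<le> a + 1 \<and> I i = circ 1 ` {a<..<b}" if "i < n" for i
    using cet1[rule_format, OF that] unfolding is_open_subinterval_def circ_arc_eq_circ .
  have I_disj: "I i \<inter> I j = {}" if "i < n" "j < n" "i \<noteq> j" for i j
    using cet2[rule_format, OF that] .
  have cover: "(\<Union>i<n. closure (I i)) = circle"
    using cet3[THEN conjunct1] .
  have T_inj: "inj_on T D" and TD: "T ` D \<subseteq> circle"
    using cet3[THEN conjunct2, THEN conjunct1]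
      cet3[THEN conjunct2, THEN conjunct2, THEN conjunct1] .
  have iso: "dist (T x) (T y) = dist x y" if "i < n" "x \<in> I i" "y \<in> I i" for i x y
    using cet3[THEN conjunct2, THEN conjunct2, THEN conjunct2, THEN conjunct1, rule_format, OF that] .
  have ID: "I i \<subseteq> D" if "i < n" for i
    using that by (auto simp: D_def cet_domain_def)
  have I_circle: "I i \<subseteq> circle" if "i < n" for i
    using subint[OF that] by auto
  have D_circle: "D \<subseteq> circle"
    using I_circle by (auto simp: D_def cet_domain_def)
  have F_fin: "finite F" "card F = num_flips n I T"
    by (auto simp: F_def num_flips_def)
  then have "F \<noteq> {}" using f by auto
  then obtain i0 where i0: "i0 < n" "is_flip T (I i0)" "i0 \<in> F" by (auto simp: F_def)
  then obtain \<kappa> where \<kappa>: "cmod \<kappa> = 1" "\<And>z. z \<in> I i0 \<Longrightarrow> T z = \<kappa> * cnj z"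
    by (auto simp: is_flip_def)
  define R where "R z = \<kappa> * cnj z" for z
  define s where "s z = R (T z)" for z
  have nn: "c * cnj c = 1" if "cmod c = 1" for c
    using that complex_norm_square[of c] by simp
  have RR: "R (R z) = z" for z
    using nn[OF \<kappa>(1)] by (simp add: R_def mult.assoc[symmetric])
  have s_id: "s z = z" if "z \<in> I i0" for z
    using \<kappa>(2)[OF that] RR by (simp add: s_def R_def)
  have s_inj: "inj_on s D"
    using T_inj RR unfolding s_def by (metis (mono_tags, lifting) inj_on_def)
  \<comment> \<open>\<open>s\<close> already takes every value in \<open>I i0\<close> on
    \<open>I i0\<close> itself, so injectivity keeps all other values out.\<close>
  have s_avoid: "s z \<notin> I i0" if "z \<in> D" "z \<notin> I i0" for z
    using s_id s_inj that ID[OF i0(1)] by (metis inj_onD subsetD)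
  obtain c0 c1 where c: "c0 < c1" "c1 \<le> c0 + 1" "I i0 = circ 1 ` {c0<..<c1}"
    using subint[OF i0(1)] by blast
  have lift: "\<exists>a b. c1 \<le> a \<and> a < b \<and> b \<le> c0 + 1 \<and> I j = circ 1 ` {a<..<b}"
    if j: "j < n" "j \<noteq> i0" for j
  proof -
    obtain p q where pq: "p < q" "I j = circ 1 ` {p<..<q}" using subint[OF j(1)] by blast
    have "circ 1 ` {p<..<q} \<inter> circ 1 ` {c0<..<c1} = {}"
      using I_disj[OF j(1) i0(1) j(2)] c(3) pq(2) by simp
    then obtain k :: int where "c1 \<le> p + k" "q + k \<le> c0 + 1"
      using arc_lift[of p q c0 c1] pq c by metis
    then show ?thesis
      using pq circ_image_shift_int[of p k q]
      by (intro exI[of _ "p + k"] exI[of _ "q + k"]) auto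
  qed
  \<comment> \<open>Written one period further on, because the points to be located lie in the
    window \<open>(c1, c1 + 1)\<close>.\<close>
  have cl_i0: "closure (I i0) = circ 1 ` {c0 + 1..c1 + 1}"
  proof -
    have "closure (I i0) = closure (circ 1 ` {c0 + of_int 1<..<c1 + of_int 1})"
      using circ_image_shift_int[of c0 1 c1] c(3) by simp
    then show ?thesis using closure_circ_image[of "c0 + 1" "c1 + 1" 1] c(1) by simp
  qed
  have cover': "c0 + 1 \<le> x \<or> (\<exists>j<n. j \<noteq> i0 \<and> circ 1 x \<in> closure (I j))"
    if x: "c1 < x" "x < c1 + 1" for x
  proof -
    have "circ 1 x \<in> (\<Union>i<n. closure (I i))" unfolding cover by simp
    then obtain j where j: "j < n" "circ 1 x \<in> closure (I j)" by blast
    show ?thesis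
    proof (cases "j = i0")
      case True
      have "circ 1 x \<in> circ 1 ` {c0 + 1..c1 + 1}" using j(2) unfolding True cl_i0 .
      then have "x \<in> {c0 + 1..c1 + 1}"
        using mem_of_circ_mem[of x "c0 + 1" "c1 + 1" c1] x c by simp
      then show ?thesis by simp
    qed (use j in blast)
  qed
  have inside: "x \<in> {a..b}"
    if "circ 1 x \<in> closure (circ 1 ` {a<..<b})" "c1 \<le> a" "a < b" "b \<le> c0 + 1" "c1 < x" "x < c1 + 1"
    for a b x
    using that closure_circ_image[of a b 1] c mem_of_circ_mem[of x a b c1] by simp
  have involution: "s (s z) = z" if z: "z \<in> D" "s z \<in> D" for z
  proof -
    obtain i j where ij: "i < n" "j < n" "z \<in> I i" "s z \<in> I j"
      using z by (auto simp: D_def cet_domain_def)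
    show ?thesis
    proof (cases "i = i0")
      case True
      then show ?thesis using s_id ij by simp
    next
      case False
      have "z \<notin> I i0" using I_disj[OF ij(1) i0(1) False] ij(3) by blast
      then have j0: "j \<noteq> i0" using s_avoid z ij(4) by blast
      have s_disj: "s ` I k \<inter> I i0 = {}" if "k < n" "k \<noteq> i0" for k
        using s_avoid ID[OF that(1)] I_disj[OF that(1) i0(1) that(2)] by blast
      show ?thesis
      proof (cases "is_flip T (I i)")
        case True
        then have "{i0, i} \<subseteq> F" using ij i0 by (auto simp: F_def)
        then have "2 \<le> card F" using False card_mono[OF F_fin(1), of "{i0, i}"] by simp
        \<comment> \<open>Two flips force \<open>n = 2\<close> here. The second arc is then the
          whole complement, and on it \<open>s\<close>, a product of two reflections, is a rotation,
          hence the identity.\<close>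
        then have n2: "n \<le> 2" using nf F_fin by simp
        then have only: "k = i" if "k < n" "k \<noteq> i0" for k
          using that False ij(1) i0(1) by linarith
        obtain a b where ab: "c1 \<le> a" "a < b" "b \<le> c0 + 1" "I i = circ 1 ` {a<..<b}"
          using lift[OF ij(1) False] by blast
        have "x \<in> {a..b}" if "c1 < x" "x < c0 + 1" for x
        proof -
          have "circ 1 x \<in> closure (I i)" using cover'[of x] only that c by force
          then show ?thesis using inside[of x a b] ab that c by simp
        qed
        then have cov: "a \<le> x \<and> x \<le> b" if "c1 < x" "x < c0 + 1" for x
          using that by simp
        have "a \<le> c1"
          by (rule no_gap[of c1 "c0 + 1"]) (use cov ab c in force)+
        moreover have "c0 + 1 \<le> b"
          by (rule no_gap[of c1 "c0 + 1"]) (use cov ab c in force)+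
        ultimately have "a = c1" "b = c0 + 1" using ab by auto
        then have Ii: "I i = circ 1 ` {c1<..<c0 + 1}" "c1 < c0 + 1" using ab by auto
        obtain \<mu> where \<mu>: "cmod \<mu> = 1" "\<And>z. z \<in> I i \<Longrightarrow> T z = \<mu> * cnj z"
          using True by (auto simp: is_flip_def)
        have s_i: "s z = \<kappa> * cnj \<mu> * z" if "z \<in> I i" for z
          using \<mu>(2)[OF that] by (simp add: s_def R_def)
        have "(\<lambda>z. \<kappa> * cnj \<mu> * z) ` I i = s ` I i" using s_i by auto
        then have "\<kappa> * cnj \<mu> = 1"
          using s_disj[OF ij(1) False] \<kappa>(1) \<mu>(1) unfolding Ii(1) c(3)
          by (intro rotation_of_complementary_arc[OF _ c(1) Ii(2)]) (simp_all add: norm_mult)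
        then show ?thesis using s_i ij(3) by simp
      next
        case nflip: False
        \<comment> \<open>An unflipped piece of \<open>T\<close> is a rotation; followed by
          \<open>R\<close> it becomes a reflection.\<close>
        have reflect: "\<exists>\<alpha>. cmod \<alpha> = 1 \<and> (\<forall>z\<in>I k. s z = \<alpha> * cnj z)"
          if k: "k < n" "\<not> is_flip T (I k)" for k
        proof -
          obtain d where d: "cmod d = 1" "\<And>z. z \<in> I k \<Longrightarrow> T z = d * z"
            using circle_isometry_cases[of "I k" T] I_circle[OF k(1)] iso[OF k(1)] k(2) TD ID[OF k(1)]
            by blast
          then show ?thesis
            using \<kappa>(1) by (intro exI[of _ "\<kappa> * cnj d"]) (auto simp: norm_mult s_def R_def)
        qed
        obtain \<alpha> where \<alpha>: "cmod \<alpha> = 1" "\<And>z. z \<in> I i \<Longrightarrow> s z = \<alpha> * cnj z"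
          using reflect[OF ij(1) nflip] by blast
        show ?thesis
        proof (cases "j = i")
          case True
          then show ?thesis
            using \<alpha>(2) ij nn[OF \<alpha>(1)] by (simp add: mult.assoc[symmetric])
        next
          case ji: False
          have "card {i0, i, j} \<le> card {..<n}"
            using ij i0 by (intro card_mono) auto
          \<comment> \<open>Three distinct arcs and at least one flip leave only
            \<open>n = 3\<close> and \<open>f = 1\<close>.\<close>
          then have n3: "n = 3" using False ji j0 nf f by auto
          then have "card F = 1" using nf f F_fin by simp
          then have "F = {i0}" using i0(3) by (auto simp: card_1_singleton_iff)
          then have jflip: "\<not> is_flip T (I j)" using ij(2) j0 by (auto simp: F_def)
          obtain \<beta> where \<beta>: "cmod \<beta> = 1" "\<And>z. z \<in> I j \<Longrightarrow> s z = \<beta> * cnj z"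
            using reflect[OF ij(2) jflip] by blast
          have only: "k = i \<or> k = j" if "k < n" "k \<noteq> i0" for k
            using that False ji j0 ij i0(1) n3 by linarith
          obtain a b where ab: "c1 \<le> a" "a < b" "b \<le> c0 + 1" "I i = circ 1 ` {a<..<b}"
            using lift[OF ij(1) False] by blast
          obtain p q where pq: "c1 \<le> p" "p < q" "q \<le> c0 + 1" "I j = circ 1 ` {p<..<q}"
            using lift[OF ij(2) j0] by blast
          have cov: "a \<le> x \<and> x \<le> b \<or> p \<le> x \<and> x \<le> q" if "c1 < x" "x < c0 + 1" for x
          proof -
            have "circ 1 x \<in> closure (I i) \<or> circ 1 x \<in> closure (I j)"
              using cover'[of x] only that c by force
            then show ?thesis
              using inside[of x a b] inside[of x p q] ab pq that c by auto
          qed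
          have gap: "r \<le> l"
            if lr: "c1 \<le> l" "r \<le> c0 + 1"
              "\<And>x. l < x \<Longrightarrow> x < r \<Longrightarrow> \<not> (a \<le> x \<and> x \<le> b) \<and> \<not> (p \<le> x \<and> x \<le> q)" for l r
          proof (rule no_gap)
            fix x assume "c1 < x" "x < c0 + 1"
            then show "\<not> (l < x \<and> x < r)" using cov[of x] lr(3)[of x] by blast
          qed (rule lr)+
          have "\<not> (x \<in> {a<..<b} \<and> x \<in> {p<..<q})" for x
            using I_disj[OF ij(1,2)] ji ab(4) pq(4) by blast
          then have "\<not> max a p < min b q"
            by (meson dense greaterThanLessThan_iff max_less_iff_conj min_less_iff_conj)
          then have "b \<le> p \<or> q \<le> a" using ab pq by (auto simp: max_def min_def split: if_splits)
          then have ends: "a = c1 \<and> b = p \<and> q = c0 + 1 \<or> p = c1 \<and> q = a \<and> b = c0 + 1"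
          proof
            assume bp: "b \<le> p"
            have "a \<le> c1" by (rule gap) (use ab pq bp in auto)
            moreover have "p \<le> b" by (rule gap) (use ab pq bp in auto)
            moreover have "c0 + 1 \<le> q" by (rule gap) (use ab pq bp in auto)
            ultimately show ?thesis using bp ab pq by auto
          next
            assume qa: "q \<le> a"
            have "p \<le> c1" by (rule gap) (use ab pq qa in auto)
            moreover have "a \<le> q" by (rule gap) (use ab pq qa in auto)
            moreover have "c0 + 1 \<le> b" by (rule gap) (use ab pq qa in auto)
            ultimately show ?thesis using qa ab pq by auto
          qed
          have imgs: "(\<lambda>z. \<alpha> * cnj z) ` I i = s ` I i" "(\<lambda>z. \<beta> * cnj z) ` I j = s ` I j"
            using \<alpha>(2) \<beta>(2) by auto
          have s_ij: "s ` I i \<inter> s ` I j = {}"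
            using inj_on_image_Int[OF s_inj ID[OF ij(1)] ID[OF ij(2)]] I_disj[OF ij(1,2)] ji by simp
          note imgs_disj = s_disj[OF ij(1) False, folded imgs] s_disj[OF ij(2) j0, folded imgs]
            s_ij[folded imgs]
          \<comment> \<open>If both arcs were invariant, \<open>s z\<close> could not have left
            \<open>I i\<close> for \<open>I j\<close>; so a single reflection acts on both arcs, and
            its square is the identity.\<close>
          from ends have "s ` I i = I i \<and> s ` I j = I j \<or> \<alpha> = \<beta>"
          proof
            assume e: "a = c1 \<and> b = p \<and> q = c0 + 1"
            have m: "c1 < b" "b < c0 + 1" using e ab pq by auto
            have "I i = circ 1 ` {c1<..<b}" "I j = circ 1 ` {b<..<c0 + 1}" using e ab(4) pq(4) by auto
            then show ?thesis
              using reflections_of_complementary_arcs[OF \<alpha>(1) \<beta>(1) c(1) m _ _ c(3) imgs_disj]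
              unfolding imgs by blast
          next
            assume e: "p = c1 \<and> q = a \<and> b = c0 + 1"
            have m: "c1 < q" "q < c0 + 1" using e ab pq by auto
            have "I j = circ 1 ` {c1<..<q}" "I i = circ 1 ` {q<..<c0 + 1}" using e ab(4) pq(4) by auto
            moreover have "s ` I j \<inter> s ` I i = {}" using s_ij by blast
            note this[folded imgs]
            ultimately show ?thesis
              using reflections_of_complementary_arcs[OF \<beta>(1) \<alpha>(1) c(1) m _ _ c(3) imgs_disj(2,1)]
              unfolding imgs by blast
          qed
          then show ?thesis
          proof
            assume "s ` I i = I i \<and> s ` I j = I j"
            then have "s z \<in> I i" using ij(3) by blast
            then show ?thesis using I_disj[OF ij(1,2)] ji ij(4) by blast
          next
            assume "\<alpha> = \<beta>"
            then show ?thesis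
              using \<alpha>(2) \<beta>(2) ij nn[OF \<alpha>(1)] by (simp add: mult.assoc[symmetric])
          qed
        qed
      qed
    qed
  qed
  have T_eq: "T z = R (s z)" if "z \<in> D" for z using RR by (simp add: s_def)
  have I0: "openin (top_of_set circle) (I i0)" "infinite (I i0)"
    using openin_circ_image[of 1 c0 c1] infinite_circ_image[of 1 c0 c1] c by simp_all
  have "\<not> circle \<subseteq> closure (cet_orbit D T p)" if p: "p \<in> circle" for p
    by (rule not_dense_of_reflection[where R = R and s = s and C = "I i0"])
      (fact D_circle TD p T_inj RR T_eq involution s_inj ID[OF i0(1)] s_id I0)+
  then show ?thesis
    unfolding cet_transitive_def D_def by blast
qed

section \<open>Exchanges given by lists of pieces\<close>

text \<open>The affine map is kept on the line, without reduction modulo \<open>L\<close>, so that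
  disjointness and jumps become linear arithmetic.\<close>

datatype piece = Piece (lo: real) (hi: real) (slope: real) (offset: real)

definition ap :: "piece \<Rightarrow> real \<Rightarrow> real" where
  "ap p x = slope p * x + offset p"

definition rigid :: "piece \<Rightarrow> bool" where
  "rigid p \<longleftrightarrow> slope p = 1 \<or> slope p = -1"

definition disjoint_images :: "piece \<Rightarrow> piece \<Rightarrow> bool" where
  "disjoint_images p q \<longleftrightarrow>
     (\<forall>x y. lo p < x \<and> x < hi p \<and> lo q < y \<and> y < hi q \<longrightarrow> ap p x \<noteq> ap q y)"

fun tiles :: "real \<Rightarrow> piece list \<Rightarrow> real \<Rightarrow> bool" where
  "tiles a [] b \<longleftrightarrow> a = b"
| "tiles a (p # ps) b \<longleftrightarrow> lo p = a \<and> lo p < hi p \<and> tiles (hi p) ps b"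

lemma tiles_append: "tiles a (ps @ qs) b \<longleftrightarrow> (\<exists>c. tiles a ps c \<and> tiles c qs b)"
  by (induction ps arbitrary: a) auto

lemma tiles_le: "tiles a ps b \<Longrightarrow> a \<le> b"
  by (induction ps arbitrary: a) force+

lemma tiles_mem: "tiles a ps b \<Longrightarrow> p \<in> set ps \<Longrightarrow> a \<le> lo p \<and> lo p < hi p \<and> hi p \<le> b"
proof (induction ps arbitrary: a)
  case (Cons q ps)
  then show ?case using tiles_le by fastforce
qed simp

lemma tiles_sorted: "tiles a ps b \<Longrightarrow> sorted_wrt (\<lambda>p q. hi p \<le> lo q) ps"
proof (induction ps arbitrary: a)
  case (Cons q ps)
  then show ?case using tiles_mem by fastforce
qed simp

lemma tiles_cover:
  "tiles a ps b \<Longrightarrow> a \<le> x \<Longrightarrow> x \<le> b \<Longrightarrow> ps \<noteq> [] \<Longrightarrow> \<exists>p\<in>set ps. lo p \<le> x \<and> x \<le> hi p"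
proof (induction ps arbitrary: a)
  case (Cons q ps)
  then show ?case by (cases "x \<le> hi q"; cases "ps = []") force+
qed simp

lemma tiles_consecutive:
  assumes "tiles a ps b" "Suc i < length ps"
  shows "hi (ps ! i) = lo (ps ! Suc i)"
  using assms
proof (induction ps arbitrary: a i)
  case (Cons q ps)
  then show ?case by (cases i; cases ps) auto
qed simp

lemma tiles_hd: "tiles a ps b \<Longrightarrow> ps \<noteq> [] \<Longrightarrow> lo (hd ps) = a"
  by (cases ps) auto

lemma tiles_last: "tiles a ps b \<Longrightarrow> ps \<noteq> [] \<Longrightarrow> hi (last ps) = b"
  by (induction ps arbitrary: a) auto

text \<open>All values lie in a window \<open>[w, w + L]\<close> of one period, so that on its interior
  disjointness on the line is disjointness on the circle.\<close>

locale piecewise_exchange =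
  fixes L w :: real and ps :: "piece list"
  assumes L_pos: "0 < L"
    and nonempty: "ps \<noteq> []"
    and tiling: "tiles 0 ps L"
    and rigid: "p \<in> set ps \<Longrightarrow> rigid p"
    and window: "p \<in> set ps \<Longrightarrow> lo p \<le> x \<Longrightarrow> x \<le> hi p \<Longrightarrow> w \<le> ap p x \<and> ap p x \<le> w + L"
    and images: "sorted_wrt disjoint_images ps"
    and jumps: "successively (\<lambda>p q. circ L (ap p (hi p)) \<noteq> circ L (ap q (lo q))) ps"
    and wrap: "circ L (ap (last ps) L) \<noteq> circ L (ap (hd ps) 0)"
begin

definition arcs :: "nat \<Rightarrow> complex set" where
  "arcs i = circ L ` {lo (ps ! i)<..<hi (ps ! i)}"

text \<open>The choice is forced on the arcs, see \<open>exchange_eq\<close>; elsewhere the value is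
  arbitrary.\<close>

definition exchange :: "complex \<Rightarrow> complex" where
  "exchange z = (SOME v. \<exists>p\<in>set ps. \<exists>x. lo p < x \<and> x < hi p \<and> circ L x = z \<and> v = circ L (ap p x))"

lemma nth_bounds: "i < length ps \<Longrightarrow> 0 \<le> lo (ps ! i) \<and> lo (ps ! i) < hi (ps ! i) \<and> hi (ps ! i) \<le> L"
  using tiles_mem[OF tiling nth_mem] .

lemma nth_ordered: "i < j \<Longrightarrow> j < length ps \<Longrightarrow> hi (ps ! i) \<le> lo (ps ! j)"
  using tiles_sorted[OF tiling] by (simp add: sorted_wrt_iff_nth_less)

lemma nth_unique:
  assumes "i < length ps" "j < length ps" "lo (ps ! i) < x" "x < hi (ps ! i)"
    "lo (ps ! j) < y" "y < hi (ps ! j)" "circ L x = circ L y"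
  shows "i = j" "x = y"
proof -
  show "x = y"
    by (rule circ_eqD[OF assms(7)]) (use nth_bounds[of i] nth_bounds[of j] assms in auto)
  then show "i = j"
    using nth_ordered[of i j] nth_ordered[of j i] assms by (cases i j rule: linorder_cases) auto
qed

lemma exchange_eq:
  assumes "i < length ps" "lo (ps ! i) < x" "x < hi (ps ! i)"
  shows "exchange (circ L x) = circ L (ap (ps ! i) x)"
  unfolding exchange_def
proof (rule some_equality)
  show "\<exists>p\<in>set ps. \<exists>y. lo p < y \<and> y < hi p \<and> circ L y = circ L x \<and>
      circ L (ap (ps ! i) x) = circ L (ap p y)"
    using assms by (intro bexI[of _ "ps ! i"] exI[of _ x]) auto
  fix v
  assume "\<exists>p\<in>set ps. \<exists>y. lo p < y \<and> y < hi p \<and> circ L y = circ L x \<and> v = circ L (ap p y)"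
  then obtain j y where "j < length ps" "lo (ps ! j) < y" "y < hi (ps ! j)"
      "circ L y = circ L x" "v = circ L (ap (ps ! j) y)"
    by (metis in_set_conv_nth)
  then show "v = circ L (ap (ps ! i) x)"
    using nth_unique[of j i y x] assms by simp
qed

lemma exchange_eq':
  assumes "p \<in> set ps" "lo p < x" "x < hi p"
  shows "exchange (circ L x) = circ L (ap p x)"
  using assms exchange_eq by (metis in_set_conv_nth)

lemma slope_cases: "i < length ps \<Longrightarrow> slope (ps ! i) = 1 \<or> slope (ps ! i) = -1"
  using rigid[OF nth_mem] by (simp add: rigid_def)

lemma window_open:
  assumes "i < length ps" "lo (ps ! i) < x" "x < hi (ps ! i)"
  shows "w < ap (ps ! i) x" "ap (ps ! i) x < w + L"
  using window[OF nth_mem, of i "lo (ps ! i)"] window[OF nth_mem, of i "hi (ps ! i)"]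
    slope_cases[OF assms(1)] assms by (auto simp: ap_def)

lemma exchange_inj: "inj_on exchange (cet_domain (length ps) arcs)"
proof (rule inj_onI)
  fix z z'
  assume z: "z \<in> cet_domain (length ps) arcs" "z' \<in> cet_domain (length ps) arcs" "exchange z = exchange z'"
  then obtain i x j y where i: "i < length ps" "lo (ps ! i) < x" "x < hi (ps ! i)" "z = circ L x"
    and j: "j < length ps" "lo (ps ! j) < y" "y < hi (ps ! j)" "z' = circ L y"
    unfolding cet_domain_def arcs_def by auto
  have eq: "ap (ps ! i) x = ap (ps ! j) y"
    by (rule circ_eqD[of L])
      (use z(3) exchange_eq[OF i(1-3)] exchange_eq[OF j(1-3)] window_open[OF i(1-3)] window_open[OF j(1-3)]
        i(4) j(4) in auto)
  have no: "\<not> k < l" if "k < length ps" "l < length ps" "lo (ps ! k) < x" "x < hi (ps ! k)"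
      "lo (ps ! l) < y" "y < hi (ps ! l)" "ap (ps ! k) x = ap (ps ! l) y" for k l x y
    using images that by (auto simp: sorted_wrt_iff_nth_less disjoint_images_def)
  have "i = j"
    using no[of i j x y] no[of j i y x] i j eq by simp
  then show "z = z'"
    using eq i(4) j(4) slope_cases[OF i(1)] by (auto simp: ap_def)
qed

lemma circ_ap:
  "slope p = 1 \<Longrightarrow> circ L (ap p x) = circ L (offset p) * circ L x"
  "slope p = -1 \<Longrightarrow> circ L (ap p x) = circ L (offset p) * cnj (circ L x)"
  using circ_add[of L "offset p" x] circ_add[of L "offset p" "- x"]
  by (simp_all add: ap_def circ_minus add.commute)

lemma exchange_isometry:
  assumes "i < length ps" "x \<in> arcs i" "y \<in> arcs i"
  shows "dist (exchange x) (exchange y) = dist x y"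
proof -
  obtain u v where uv: "x = circ L u" "y = circ L v" "lo (ps ! i) < u" "u < hi (ps ! i)"
      "lo (ps ! i) < v" "v < hi (ps ! i)"
    using assms by (auto simp: arcs_def)
  have m: "cmod (c * a - c * b) = cmod (a - b)" if "cmod c = 1" for a b c :: complex
    using that by (simp add: norm_mult flip: right_diff_distrib)
  have n: "cmod (cnj a - cnj b) = cmod (a - b)" for a b
    by (metis complex_cnj_diff complex_mod_cnj)
  show ?thesis
    using slope_cases[OF assms(1)] uv exchange_eq[OF assms(1)]
    by (auto simp: circ_ap dist_norm m n)
qed

lemma closure_arcs: "i < length ps \<Longrightarrow> closure (arcs i) = circ L ` {lo (ps ! i)..hi (ps ! i)}"
  unfolding arcs_def using nth_bounds by (intro closure_circ_image) auto

lemma cover_arcs: "(\<Union>i<length ps. closure (arcs i)) = circle"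
proof (intro subset_antisym subsetI)
  fix z assume "z \<in> circle"
  then obtain x where x: "0 \<le> x" "x < 0 + L" "circ L x = z" using circ_surj L_pos by blast
  then obtain p where "p \<in> set ps" "lo p \<le> x" "x \<le> hi p"
    using tiles_cover[OF tiling, of x] nonempty by auto
  then obtain i where "i < length ps" "x \<in> {lo (ps ! i)..hi (ps ! i)}"
    by (metis in_set_conv_nth atLeastAtMost_iff)
  then show "z \<in> (\<Union>i<length ps. closure (arcs i))"
    using closure_arcs x(3) by blast
qed (auto simp: closure_arcs)

text \<open>A continuous extension must take the one-sided limit of the piece; the limit is reached
  along points that run from its midpoint towards \<open>e\<close>.\<close>

lemma extension_at_endpoint:
  assumes i: "i < length ps" and e: "e = lo (ps ! i) \<or> e = hi (ps ! i)"
    and g: "continuous_on U g" "cet_domain (length ps) arcs \<subseteq> U" "circ L e \<in> U"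
    and ext: "\<And>z. z \<in> cet_domain (length ps) arcs \<Longrightarrow> g z = exchange z"
  shows "g (circ L e) = circ L (ap (ps ! i) e)"
proof -
  define m where "m = (lo (ps ! i) + hi (ps ! i)) / 2"
  define x where "x n = e + (m - e) / real (Suc (Suc n))" for n
  have x_in: "lo (ps ! i) < x n \<and> x n < hi (ps ! i)" for n
  proof -
    define d where "d = (hi (ps ! i) - lo (ps ! i)) / 2"
    have "0 < d" using nth_bounds[OF i] by (simp add: d_def)
    then have "0 < d / real (Suc (Suc n))" "d / real (Suc (Suc n)) < d"
      by (auto simp: divide_less_eq)
    moreover have "m = lo (ps ! i) + d" "hi (ps ! i) = lo (ps ! i) + 2 * d"
      by (auto simp: m_def d_def field_simps)
    ultimately show ?thesis using e unfolding x_def by auto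
  qed
  have "(\<lambda>n. (m - e) / real (Suc (Suc n))) \<longlonglongrightarrow> 0"
    using LIMSEQ_Suc[OF LIMSEQ_Suc[OF lim_const_over_n[of "m - e"]]] by simp
  then have x_lim: "x \<longlonglongrightarrow> e"
    unfolding x_def using tendsto_add[OF tendsto_const] by force
  have dom: "circ L (x n) \<in> cet_domain (length ps) arcs" for n
    using x_in i by (auto simp: cet_domain_def arcs_def intro!: bexI[of _ i])
  have "(\<lambda>n. circ L (x n)) \<longlonglongrightarrow> circ L e"
    using isCont_tendsto_compose[OF isCont_circ x_lim] .
  then have "(\<lambda>n. g (circ L (x n))) \<longlonglongrightarrow> g (circ L e)"
    using g dom by (intro continuous_on_tendsto_compose[OF g(1)]) (auto intro!: always_eventually)
  moreover have "g (circ L (x n)) = circ L (ap (ps ! i) (x n))" for n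
    using ext[OF dom] exchange_eq[OF i] x_in by simp
  moreover have "(\<lambda>n. circ L (ap (ps ! i) (x n))) \<longlonglongrightarrow> circ L (ap (ps ! i) e)"
    unfolding ap_def
    by (intro isCont_tendsto_compose[OF isCont_circ] tendsto_intros x_lim)
  ultimately show ?thesis
    using LIMSEQ_unique by auto
qed

text \<open>A point of \<open>U\<close> outside the arcs is an endpoint shared by two cyclically
  adjacent pieces, whose one-sided limits differ by \<open>jumps\<close>, or by \<open>wrap\<close>
  at the point where 0 and \<open>L\<close> are glued.\<close>

lemma no_extension:
  assumes U: "cet_domain (length ps) arcs \<subset> U" "U \<subseteq> circle" and g: "continuous_on U g"
    and ext: "\<And>z. z \<in> cet_domain (length ps) arcs \<Longrightarrow> g z = exchange z"
  shows False
proof -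
  obtain z where z: "z \<in> U" "z \<notin> cet_domain (length ps) arcs" using U by blast
  then have "z \<in> (\<Union>i<length ps. closure (arcs i))" using U(2) cover_arcs by blast
  then obtain i x where i: "i < length ps" "lo (ps ! i) \<le> x" "x \<le> hi (ps ! i)" "z = circ L x"
    using closure_arcs by auto
  have x: "x = lo (ps ! i) \<or> x = hi (ps ! i)"
    using i z(2) unfolding cet_domain_def arcs_def by force
  have lim: "g (circ L e) = circ L (ap (ps ! j) e)"
    if "j < length ps" "e = lo (ps ! j) \<or> e = hi (ps ! j)" "circ L e \<in> U" for j e
    by (rule extension_at_endpoint[OF that(1,2) g psubset_imp_subset[OF U(1)] that(3) ext])
  define n where "n = length ps"
  have n: "n > 0" "last ps = ps ! (n - 1)" "hd ps = ps ! 0"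
    using nonempty by (auto simp: n_def last_conv_nth hd_conv_nth)
  have jump: "circ L (ap (ps ! j) (hi (ps ! j))) \<noteq> circ L (ap (ps ! Suc j) (lo (ps ! Suc j)))"
    if "Suc j < n" for j
    using jumps that by (simp add: successively_conv_nth n_def)
  have zL: "circ L 0 = circ L L" using circ_add_period[of L 0 1] L_pos by simp
  have ends: "lo (ps ! 0) = 0" "hi (ps ! (n - 1)) = L"
    using tiles_hd[OF tiling nonempty] tiles_last[OF tiling nonempty] n by auto
  have inner: False if "Suc j < n" "circ L (hi (ps ! j)) \<in> U" for j
    using lim[of j "hi (ps ! j)"] lim[of "Suc j" "hi (ps ! j)"] jump[OF that(1)] that
      tiles_consecutive[OF tiling, of j] by (simp add: n_def)
  have outer: False if "circ L 0 \<in> U"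
    using lim[of 0 0] lim[of "n - 1" L] that wrap ends n zL by (simp add: n_def)
  from x show False
  proof
    assume lo: "x = lo (ps ! i)"
    show False
    proof (cases i)
      case 0
      then show False using outer lo ends z i(4) by simp
    next
      case (Suc j)
      then show False
        using inner[of j] lo z i tiles_consecutive[OF tiling, of j] by (simp add: n_def)
    qed
  next
    assume hi: "x = hi (ps ! i)"
    show False
    proof (cases "Suc i < n")
      case True
      then show False using inner[of i] hi z i by simp
    next
      case False
      then have "i = n - 1" using i n_def by simp
      then show False using outer hi ends z i(4) zL by simp
    qed
  qed
qed

lemma is_CET: "is_CET (length ps) arcs exchange"
  unfolding is_CET_def
proof (intro conjI allI impI ballI)
  fix i assume i: "i < length ps"
  show "is_open_subinterval (arcs i)"
    unfolding arcs_def using nth_bounds[OF i] L_pos by (intro circ_image_subinterval) auto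
next
  fix i j assume ij: "i < length ps" "j < length ps" "i \<noteq> j"
  show "arcs i \<inter> arcs j = {}"
  proof (rule ccontr)
    assume "\<not> ?thesis"
    then obtain x y where "lo (ps ! i) < x" "x < hi (ps ! i)" "lo (ps ! j) < y" "y < hi (ps ! j)"
      "circ L x = circ L y"
      unfolding arcs_def by auto
    then show False using nth_unique(1)[OF ij(1,2)] ij(3) by blast
  qed
next
  show "exchange ` cet_domain (length ps) arcs \<subseteq> circle"
    unfolding cet_domain_def arcs_def using exchange_eq by auto
next
  show "\<not> (\<exists>U g. openin (top_of_set circle) U \<and> cet_domain (length ps) arcs \<subset> U \<and>
      continuous_on U g \<and> g ` U \<subseteq> circle \<and> (\<forall>z\<in>cet_domain (length ps) arcs. g z = exchange z))"
  proof
    assume "\<exists>U g. openin (top_of_set circle) U \<and> cet_domain (length ps) arcs \<subset> U \<and>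
      continuous_on U g \<and> g ` U \<subseteq> circle \<and> (\<forall>z\<in>cet_domain (length ps) arcs. g z = exchange z)"
    then obtain U g where "openin (top_of_set circle) U" "cet_domain (length ps) arcs \<subset> U"
      "continuous_on U g" "\<And>z. z \<in> cet_domain (length ps) arcs \<Longrightarrow> g z = exchange z" by blast
    moreover have "U \<subseteq> circle" using calculation(1) openin_subset by fastforce
    ultimately show False by (intro no_extension)
  qed
qed (fact cover_arcs exchange_inj | rule exchange_isometry; assumption)+

text \<open>If a translation agreed with a reflection on an interval, \<open>2 * x\<close> would be
  constant modulo \<open>L\<close> there.\<close>

lemma is_flip_iff:
  assumes i: "i < length ps"
  shows "is_flip exchange (arcs i) \<longleftrightarrow> slope (ps ! i) = -1"
proof
  assume "slope (ps ! i) = -1"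
  then show "is_flip exchange (arcs i)"
    unfolding is_flip_def arcs_def using exchange_eq[OF i]
    by (intro exI[of _ "circ L (offset (ps ! i))"]) (auto simp: circ_ap)
next
  assume "is_flip exchange (arcs i)"
  then obtain c where c: "cmod c = 1" "\<And>z. z \<in> arcs i \<Longrightarrow> exchange z = c * cnj z"
    by (auto simp: is_flip_def)
  show "slope (ps ! i) = -1"
  proof (rule ccontr)
    assume "slope (ps ! i) \<noteq> -1"
    then have s: "slope (ps ! i) = 1" using slope_cases[OF i] by simp
    obtain t where t: "circ L t = c" using circ_surj[of c L 0] c L_pos by auto
    have sq: "circ L (2 * x) = circ L (t - offset (ps ! i))"
      if "lo (ps ! i) < x" "x < hi (ps ! i)" for x
    proof -
      have "circ L (offset (ps ! i)) * circ L x = circ L t * circ L (- x)"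
        using c(2)[of "circ L x"] that exchange_eq[OF i that] s t
        by (auto simp: arcs_def circ_ap circ_minus)
      then have "circ L (offset (ps ! i) + x) = circ L (t - x)"
        by (simp add: circ_add[of L _ x] circ_add[of L t "- x", simplified])
      then obtain k :: int where "offset (ps ! i) + x = t - x + k * L"
        using circ_eq_iff[of L "offset (ps ! i) + x" "t - x"] L_pos by auto
      then have "2 * x = t - offset (ps ! i) + k * L" by simp
      then show ?thesis using circ_add_period L_pos by simp
    qed
    define d where "d = hi (ps ! i) - lo (ps ! i)"
    have d: "0 < d" "d \<le> L" using nth_bounds[OF i] by (auto simp: d_def)
    \<comment> \<open>The thirds of the interval are tested: after doubling they are
      \<open>2 * d / 3\<close> apart, which is less than \<open>L\<close>.\<close>
    have "circ L (2 * (lo (ps ! i) + d / 3)) = circ L (2 * (lo (ps ! i) + 2 * d / 3))"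
      using d by (subst (1 2) sq) (auto simp: d_def field_simps)
    moreover have "\<bar>2 * (lo (ps ! i) + d / 3) - 2 * (lo (ps ! i) + 2 * d / 3)\<bar> < L"
    proof -
      have "2 * (lo (ps ! i) + d / 3) - 2 * (lo (ps ! i) + 2 * d / 3) = - (2 * d / 3)"
        by (simp add: field_simps)
      then show ?thesis using d by linarith
    qed
    ultimately have "2 * (lo (ps ! i) + d / 3) = 2 * (lo (ps ! i) + 2 * d / 3)"
      by (rule circ_eqD)
    then show False using d by simp
  qed
qed

lemma num_flips: "num_flips (length ps) arcs exchange = length (filter (\<lambda>p. slope p = -1) ps)"
proof -
  have "{i. i < length ps \<and> is_flip exchange (arcs i)} = {i. i < length ps \<and> slope (ps ! i) = -1}"
    using is_flip_iff by blast
  then show ?thesis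
    by (simp add: num_flips_def length_filter_conv_card)
qed

text \<open>The dynamics lifted to the line. The free \<open>k\<close> chooses the representative,
  so that a path can continue inside \<open>[0, L]\<close>.\<close>

definition moves :: "real \<Rightarrow> real \<Rightarrow> bool" where
  "moves x y \<longleftrightarrow> (\<exists>p\<in>set ps. \<exists>k::int. lo p < x \<and> x < hi p \<and> y = ap p x + k * L)"

lemma moves_orbit:
  assumes "moves\<^sup>*\<^sup>* x y"
  shows "\<exists>k. reaches (cet_domain (length ps) arcs) exchange k (circ L x) (circ L y)"
  using assms
proof (induction rule: converse_rtranclp_induct)
  case base
  have "reaches (cet_domain (length ps) arcs) exchange 0 (circ L y) (circ L y)" by simp
  then show ?case by blast
next
  case (step x x')
  then obtain k p and l :: int where k: "reaches (cet_domain (length ps) arcs) exchange k (circ L x') (circ L y)"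
    and p: "p \<in> set ps" "lo p < x" "x < hi p" "x' = ap p x + l * L"
    unfolding moves_def by blast
  have "circ L x' = exchange (circ L x)"
    using p exchange_eq' L_pos by simp
  moreover have "circ L x \<in> cet_domain (length ps) arcs"
  proof -
    obtain i where "i < length ps" "p = ps ! i" using p(1) by (metis in_set_conv_nth)
    then show ?thesis using p(2,3) by (auto simp: cet_domain_def arcs_def intro!: bexI[of _ i])
  qed
  ultimately have "reaches (cet_domain (length ps) arcs) exchange (Suc k) (circ L x) (circ L y)"
    using k by (simp add: reaches_Suc)
  then show ?case by blast
qed

text \<open>The forward orbit is already dense: density of its lift in \<open>[0, L]\<close> passes
  through the continuous map \<open>circ L\<close>.\<close>

lemma transitive:
  assumes dense: "\<And>u v. 0 \<le> u \<Longrightarrow> u < v \<Longrightarrow> v \<le> L \<Longrightarrow> \<exists>y. moves\<^sup>*\<^sup>* x y \<and> u < y \<and> y < v"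
  shows "cet_transitive (length ps) arcs exchange"
  unfolding cet_transitive_def
proof (intro bexI[of _ "circ L x"] subsetI)
  fix z assume "z \<in> circle"
  then obtain t where t: "0 \<le> t" "t < 0 + L" "circ L t = z" using circ_surj L_pos by blast
  let ?Orb = "cet_orbit (cet_domain (length ps) arcs) exchange (circ L x)"
  define S where "S = {y. moves\<^sup>*\<^sup>* x y}"
  have "t \<in> closure S"
    unfolding closure_approachable
  proof (intro allI impI)
    fix e :: real assume "0 < e"
    then have "t < min L (t + e)" using t(2) by simp
    from dense[OF t(1) this min.cobounded1]
    obtain y where "moves\<^sup>*\<^sup>* x y" "t < y" "y < min L (t + e)" by blast
    then show "\<exists>y\<in>S. dist y t < e"
      by (intro bexI[of _ y]) (auto simp: S_def dist_real_def)
  qed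
  moreover have "circ L ` closure S \<subseteq> closure ?Orb"
  proof (rule image_closure_subset)
    show "continuous_on (closure S) (circ L)" using continuous_on_circ[of _ "\<lambda>x. x"] by simp
    show "circ L ` S \<subseteq> closure ?Orb"
    proof -
      have "circ L ` S \<subseteq> ?Orb"
        using moves_orbit[of x] unfolding S_def cet_orbit_eq by blast
      then show ?thesis using closure_subset[of ?Orb] by (rule subset_trans)
    qed
  qed simp
  ultimately show "z \<in> closure ?Orb" using t by blast
qed simp

end

section \<open>Gadgets\<close>

text \<open>The counterpart of \<open>moves\<close> before any circle is chosen: there is no period
  to subtract.\<close>

definition step :: "piece list \<Rightarrow> real \<Rightarrow> real \<Rightarrow> bool" where
  "step ps x y \<longleftrightarrow> (\<exists>p\<in>set ps. lo p < x \<and> x < hi p \<and> y = ap p x)"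

text \<open>Conjugation of a piece by the translation by \<open>d\<close>; the offset is the one
  that makes \<open>ap_shift\<close> true.\<close>

definition shift :: "real \<Rightarrow> piece \<Rightarrow> piece" where
  "shift d p = Piece (lo p + d) (hi p + d) (slope p) (offset p + d - slope p * d)"

lemma shift_sel [simp]:
  "lo (shift d p) = lo p + d" "hi (shift d p) = hi p + d" "slope (shift d p) = slope p"
  by (simp_all add: shift_def)

lemma rigid_shift [simp]: "rigid (shift d p) \<longleftrightarrow> rigid p"
  by (simp add: rigid_def)

lemma ap_shift: "ap (shift d p) x = ap p (x - d) + d"
  by (simp add: ap_def shift_def algebra_simps)

lemma disjoint_images_shift [simp]:
  "disjoint_images (shift d p) (shift d q) \<longleftrightarrow> disjoint_images p q"
proof
  assume L: "disjoint_images (shift d p) (shift d q)"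
  show "disjoint_images p q"
    unfolding disjoint_images_def
  proof (intro allI impI)
    fix x y assume "lo p < x \<and> x < hi p \<and> lo q < y \<and> y < hi q"
    then show "ap p x \<noteq> ap q y"
      using L[unfolded disjoint_images_def, rule_format, of "x + d" "y + d"] by (simp add: ap_shift)
  qed
next
  assume R: "disjoint_images p q"
  show "disjoint_images (shift d p) (shift d q)"
    unfolding disjoint_images_def
  proof (intro allI impI)
    fix x y assume "lo (shift d p) < x \<and> x < hi (shift d p) \<and> lo (shift d q) < y \<and> y < hi (shift d q)"
    then show "ap (shift d p) x \<noteq> ap (shift d q) y"
      using R[unfolded disjoint_images_def, rule_format, of "x - d" "y - d"] by (simp add: ap_shift)
  qed
qed

lemma tiles_shift: "tiles a ps b \<Longrightarrow> tiles (a + d) (map (shift d) ps) (b + d)"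
  by (induction ps arbitrary: a) auto

lemma step_shift:
  assumes "step ps x y"
  shows "step (map (shift d) ps) (x + d) (y + d)"
proof -
  obtain p where p: "p \<in> set ps" "lo p < x" "x < hi p" "y = ap p x"
    using assms unfolding step_def by blast
  then show ?thesis
    unfolding step_def by (intro bexI[of _ "shift d p"]) (simp_all add: ap_shift)
qed

lemma steps_mono:
  assumes "(step ps)\<^sup>*\<^sup>* x y" "set ps \<subseteq> set qs"
  shows "(step qs)\<^sup>*\<^sup>* x y"
proof -
  have "step ps \<le> step qs" using assms(2) unfolding step_def by blast
  then show ?thesis using rtranclp_mono assms(1) by blast
qed

lemma steps_shift: "(step ps)\<^sup>*\<^sup>* x y \<Longrightarrow> (step (map (shift d) ps))\<^sup>*\<^sup>* (x + d) (y + d)"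
  by (induction rule: rtranclp_induct) (auto intro: rtranclp.rtrancl_into_rtrancl step_shift)

text \<open>A gadget acts on the unit blocks of \<open>[0, m]\<close>: every point of the first block runs
  through all blocks, isometrically, and leaves with its orientation restored into \<open>[m, m + 1]\<close>.\<close>

definition gadget :: "nat \<Rightarrow> piece list \<Rightarrow> bool" where
  "gadget m ps \<longleftrightarrow>
     tiles 0 ps m \<and> (\<forall>p\<in>set ps. rigid p) \<and>
     (\<forall>p\<in>set ps. \<forall>x. lo p \<le> x \<and> x \<le> hi p \<longrightarrow> 1 \<le> ap p x \<and> ap p x \<le> real m + 1) \<and>
     sorted_wrt disjoint_images ps \<and>
     successively (\<lambda>p q. ap p (hi p) \<noteq> ap q (lo q)) ps \<and>
     (ps \<noteq> [] \<longrightarrow> 2 \<le> ap (hd ps) 0 \<and> ap (hd ps) 0 \<le> m \<and> ap (last ps) m \<le> m) \<and>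
     (\<forall>u. 0 < u \<and> u < 1 \<longrightarrow> (step ps)\<^sup>*\<^sup>* u (real m + u)) \<and>
     (\<forall>i<m. (\<forall>u. 0 < u \<and> u < 1 \<longrightarrow> (step ps)\<^sup>*\<^sup>* u (real i + u)) \<or>
            (\<forall>u. 0 < u \<and> u < 1 \<longrightarrow> (step ps)\<^sup>*\<^sup>* u (real i + 1 - u)))"

lemma gadgetD:
  assumes "gadget m ps"
  shows "tiles 0 ps m" "p \<in> set ps \<Longrightarrow> rigid p"
    "p \<in> set ps \<Longrightarrow> lo p \<le> x \<Longrightarrow> x \<le> hi p \<Longrightarrow> 1 \<le> ap p x \<and> ap p x \<le> real m + 1"
    "sorted_wrt disjoint_images ps"
    "successively (\<lambda>p q. ap p (hi p) \<noteq> ap q (lo q)) ps"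
    "ps \<noteq> [] \<Longrightarrow> 2 \<le> ap (hd ps) 0" "ps \<noteq> [] \<Longrightarrow> ap (hd ps) 0 \<le> m"
    "ps \<noteq> [] \<Longrightarrow> ap (last ps) m \<le> m"
    "0 < u \<Longrightarrow> u < 1 \<Longrightarrow> (step ps)\<^sup>*\<^sup>* u (real m + u)"
    "i < m \<Longrightarrow> (\<forall>u. 0 < u \<and> u < 1 \<longrightarrow> (step ps)\<^sup>*\<^sup>* u (real i + u)) \<or>
            (\<forall>u. 0 < u \<and> u < 1 \<longrightarrow> (step ps)\<^sup>*\<^sup>* u (real i + 1 - u))"
  using assms unfolding gadget_def by simp_all

text \<open>Strictness separates the images of a gadget from whatever occupies the values above
  \<open>m + 1\<close>.\<close>

lemma gadget_interior:
  assumes "gadget m ps" "p \<in> set ps" "lo p < x" "x < hi p"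
  shows "ap p x < real m + 1"
proof -
  have "slope p = 1 \<or> slope p = -1" using gadgetD(2)[OF assms(1,2)] by (simp add: rigid_def)
  moreover have "ap p (lo p) \<le> real m + 1" "ap p (hi p) \<le> real m + 1"
    using gadgetD(3)[OF assms(1,2), of "lo p"] gadgetD(3)[OF assms(1,2), of "hi p"] assms(3,4) by auto
  ultimately show ?thesis using assms(3,4) by (auto simp: ap_def)
qed

lemma gadget_Nil: "gadget 0 []"
  by (simp add: gadget_def)

text \<open>The values of \<open>ps\<close> lie in \<open>[1, m + 1]\<close> and those of the
  shifted \<open>qs\<close> in \<open>[m + 1, m + n + 1]\<close>. A point leaves \<open>ps\<close>
  in \<open>[m, m + 1]\<close>, the first block of the shifted \<open>qs\<close>. At the seam the
  left limit is at most \<open>m\<close> and the right limit at least \<open>m + 2\<close>, so no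
  two pieces merge.\<close>

lemma gadget_append:
  assumes g: "gadget m ps" and h: "gadget n qs"
  shows "gadget (m + n) (ps @ map (shift m) qs)"
proof -
  let ?qs = "map (shift m) qs"
  note G = gadgetD[OF g] and H = gadgetD[OF h]
  have tiling: "tiles 0 (ps @ ?qs) (real (m + n))"
    using G(1) tiles_shift[OF H(1), of m] by (auto simp: tiles_append add.commute)
  have qs_range: "real m + 1 \<le> ap p x \<and> ap p x \<le> real (m + n) + 1"
    if "p \<in> set ?qs" "lo p \<le> x" "x \<le> hi p" for p x
    using that H(3)[of _ "x - m"] by (auto simp: ap_shift)
  have range: "1 \<le> ap p x \<and> ap p x \<le> real (m + n) + 1"
    if p: "p \<in> set (ps @ ?qs)" "lo p \<le> x" "x \<le> hi p" for p x
  proof (cases "p \<in> set ps")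
    case True
    then show ?thesis using G(3)[OF True p(2,3)] by simp
  next
    case False
    then show ?thesis using qs_range[of p x] p by auto
  qed
  have cross: "disjoint_images p q" if pq: "p \<in> set ps" "q \<in> set ?qs" for p q
  proof -
    have "ap p x \<noteq> ap q y" if xy: "lo p < x" "x < hi p" "lo q < y" "y < hi q" for x y
      using gadget_interior[OF g pq(1) xy(1,2)] qs_range[OF pq(2), of y] xy by auto
    then show ?thesis by (simp add: disjoint_images_def)
  qed
  have images: "sorted_wrt disjoint_images (ps @ ?qs)"
    using G(4) H(4) cross by (auto simp: sorted_wrt_append sorted_wrt_map)
  have jump: "successively (\<lambda>p q. ap p (hi p) \<noteq> ap q (lo q)) (ps @ ?qs)"
  proof -
    have "successively (\<lambda>p q. ap p (hi p) \<noteq> ap q (lo q)) ?qs"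
      using H(5) by (simp add: successively_map ap_shift)
    moreover have "ap (last ps) (hi (last ps)) \<noteq> ap (hd ?qs) (lo (hd ?qs))"
      if "ps \<noteq> []" "qs \<noteq> []"
      using G(8)[OF that(1)] H(6)[OF that(2)] that tiles_last[OF G(1)] tiles_hd[OF H(1)]
      by (simp add: hd_map ap_shift)
    ultimately show ?thesis
      using G(5) by (cases "ps = []"; cases "qs = []") (simp_all add: successively_append_iff)
  qed
  have ends: "2 \<le> ap (hd (ps @ ?qs)) 0 \<and> ap (hd (ps @ ?qs)) 0 \<le> real (m + n) \<and>
      ap (last (ps @ ?qs)) (real (m + n)) \<le> real (m + n)"
    if "ps @ ?qs \<noteq> []"
  proof -
    have m0: "m = 0" if "ps = []" using G(1) that by simp
    have n0: "n = 0" if "qs = []" using H(1) that by simp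
    show ?thesis
      using G(6-8) H(6-8) m0 n0 that
      by (cases "ps = []"; cases "qs = []") (auto simp: hd_map last_map ap_shift)
  qed
  have steps_l: "(step (ps @ ?qs))\<^sup>*\<^sup>* x y" if "(step ps)\<^sup>*\<^sup>* x y" for x y
    using steps_mono[OF that, of "ps @ ?qs"] by simp
  have steps_r: "(step (ps @ ?qs))\<^sup>*\<^sup>* (real m + x) (real m + y)" if "(step qs)\<^sup>*\<^sup>* x y" for x y
    using steps_mono[OF steps_shift[OF that, of m], of "ps @ ?qs"] by (simp add: add.commute)
  have enter: "(step (ps @ ?qs))\<^sup>*\<^sup>* u (real m + x)"
    if u: "0 < u" "u < 1" and x: "(step qs)\<^sup>*\<^sup>* u x" for u x
    using rtranclp_trans[OF steps_l[OF G(9)[OF u]] steps_r[OF x]] .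
  have exit: "(step (ps @ ?qs))\<^sup>*\<^sup>* u (real (m + n) + u)" if u: "0 < u" "u < 1" for u
    using enter[OF u H(9)[OF u]] by (simp add: add.assoc)
  have visit: "(\<forall>u. 0 < u \<and> u < 1 \<longrightarrow> (step (ps @ ?qs))\<^sup>*\<^sup>* u (real i + u)) \<or>
            (\<forall>u. 0 < u \<and> u < 1 \<longrightarrow> (step (ps @ ?qs))\<^sup>*\<^sup>* u (real i + 1 - u))" if i: "i < m + n" for i
  proof (cases "i < m")
    case True
    from G(10)[OF True] show ?thesis
      by (rule disj_forward) (intro allI impI steps_l, blast)+
  next
    case False
    then obtain j where j: "i = m + j" "j < n" using i le_Suc_ex[of m i] by auto
    have eq: "real (m + j) + u = real m + (real j + u)"
      "real (m + j) + 1 - u = real m + (real j + 1 - u)" for u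
      by simp_all
    from H(10)[OF j(2)] show ?thesis
    proof
      assume A: "\<forall>u. 0 < u \<and> u < 1 \<longrightarrow> (step qs)\<^sup>*\<^sup>* u (real j + u)"
      have "(step (ps @ ?qs))\<^sup>*\<^sup>* u (real i + u)" if "0 < u" "u < 1" for u
        unfolding j(1) eq(1) by (rule enter[OF that A[rule_format, OF conjI[OF that]]])
      then show ?thesis by simp
    next
      assume A: "\<forall>u. 0 < u \<and> u < 1 \<longrightarrow> (step qs)\<^sup>*\<^sup>* u (real j + 1 - u)"
      have "(step (ps @ ?qs))\<^sup>*\<^sup>* u (real i + 1 - u)" if "0 < u" "u < 1" for u
        unfolding j(1) eq(2) by (rule enter[OF that A[rule_format, OF conjI[OF that]]])
      then show ?thesis by simp
    qed
  qed
  have rigids: "\<forall>p\<in>set (ps @ ?qs). rigid p"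
    using G(2) H(2) by auto
  show ?thesis
    unfolding gadget_def
    using tiling rigids range images jump ends exit visit by blast
qed

text \<open>The orbit of the first block is listed as pairs \<open>(\<sigma>, c)\<close> standing for \<open>u \<mapsto> \<sigma> u + c\<close>.\<close>

lemma gadgetI:
  assumes "tiles 0 ps m" "\<forall>p\<in>set ps. rigid p"
    "\<forall>p\<in>set ps. 1 \<le> ap p (lo p) \<and> ap p (lo p) \<le> real m + 1 \<and> 1 \<le> ap p (hi p) \<and> ap p (hi p) \<le> real m + 1"
    "sorted_wrt disjoint_images ps"
    "successively (\<lambda>p q. ap p (hi p) \<noteq> ap q (lo q)) ps"
    "2 \<le> ap (hd ps) 0" "ap (hd ps) 0 \<le> m" "ap (last ps) m \<le> m"
    and path: "successively (\<lambda>(\<sigma>, c) (\<sigma>', c').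
        \<forall>u. 0 < u \<and> u < 1 \<longrightarrow> step ps (\<sigma> * u + c) (\<sigma>' * u + c')) ((1, 0) # rs)"
    and exit: "(1, real m) \<in> set ((1, 0) # rs)"
    and visit: "\<forall>i<m. (1, real i) \<in> set ((1, 0) # rs) \<or> (-1, real i + 1) \<in> set ((1, 0) # rs)"
  shows "gadget m ps"
proof -
  have walk: "(step ps)\<^sup>*\<^sup>* (\<sigma> * u + c) (\<sigma>' * u + c')"
    if "successively (\<lambda>(\<sigma>, c) (\<sigma>', c').
        \<forall>u. 0 < u \<and> u < 1 \<longrightarrow> step ps (\<sigma> * u + c) (\<sigma>' * u + c')) ((\<sigma>, c) # rs)"
      "(\<sigma>', c') \<in> set ((\<sigma>, c) # rs)" "0 < u" "u < 1" for \<sigma> c \<sigma>' c' u rs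
    using that(1,2)
  proof (induction rs arbitrary: \<sigma> c)
    case (Cons r rs)
    obtain \<tau> d where r: "r = (\<tau>, d)" by (cases r)
    show ?case
    proof (cases "(\<sigma>', c') = (\<sigma>, c)")
      case False
      then have "(step ps)\<^sup>*\<^sup>* (\<tau> * u + d) (\<sigma>' * u + c')"
        using Cons.prems r by (intro Cons.IH) auto
      moreover have "step ps (\<sigma> * u + c) (\<tau> * u + d)"
        using Cons.prems(1) r that(3,4) by simp
      ultimately show ?thesis by (rule converse_rtranclp_into_rtranclp[rotated])
    qed auto
  qed auto
  have walk1: "(step ps)\<^sup>*\<^sup>* u (\<sigma> * u + c)" if "(\<sigma>, c) \<in> set ((1, 0) # rs)" "0 < u" "u < 1" for \<sigma> c u
    using walk[OF path that] by simp
  have range: "1 \<le> ap p x \<and> ap p x \<le> real m + 1" if p: "p \<in> set ps" "lo p \<le> x" "x \<le> hi p" for p x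
  proof -
    have "slope p = 1 \<or> slope p = -1" using assms(2) p(1) by (simp add: rigid_def)
    moreover have "1 \<le> ap p (lo p) \<and> ap p (lo p) \<le> real m + 1 \<and> 1 \<le> ap p (hi p) \<and> ap p (hi p) \<le> real m + 1"
      using assms(3) p(1) by blast
    ultimately show ?thesis using p(2,3) by (auto simp: ap_def)
  qed
  have out: "(step ps)\<^sup>*\<^sup>* u (real m + u)" if "0 < u" "u < 1" for u
    using walk1[OF exit that] by (simp add: add.commute)
  have all: "(\<forall>u. 0 < u \<and> u < 1 \<longrightarrow> (step ps)\<^sup>*\<^sup>* u (real i + u)) \<or>
            (\<forall>u. 0 < u \<and> u < 1 \<longrightarrow> (step ps)\<^sup>*\<^sup>* u (real i + 1 - u))" if i: "i < m" for i
    using visit[rule_format, OF i]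
  proof
    assume "(1, real i) \<in> set ((1, 0) # rs)"
    from walk1[OF this] show ?thesis by (simp add: add.commute)
  next
    assume "(-1, real i + 1) \<in> set ((1, 0) # rs)"
    from walk1[OF this] show ?thesis by simp
  qed
  show ?thesis
    unfolding gadget_def using assms(1,2,4-8) range out all by blast
qed

section \<open>Counting pieces and flips: the basic gadgets\<close>

lemmas gadget_simps = step_def ap_def rigid_def disjoint_images_def less_Suc_eq numeral_eq_Suc

text \<open>Counts the pieces of the gadget only; closing the circle adds one unflipped piece or
  three flipped ones.\<close>

definition realizable :: "nat \<Rightarrow> nat \<Rightarrow> bool" where
  "realizable n f \<longleftrightarrow>
     (\<exists>m ps. gadget m ps \<and> length ps = n \<and> length (filter (\<lambda>p. slope p = -1) ps) = f)"

lemma realizable_0: "realizable 0 0"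
proof -
  have "length ([] :: piece list) = 0" "length (filter (\<lambda>p. slope p = -1) []) = 0" by simp_all
  then show ?thesis unfolding realizable_def using gadget_Nil by blast
qed

lemma realizable_add:
  assumes "realizable n f" "realizable n' f'"
  shows "realizable (n + n') (f + f')"
proof -
  obtain m ps m' ps' where "gadget m ps" "length ps = n" "length (filter (\<lambda>p. slope p = -1) ps) = f"
    "gadget m' ps'" "length ps' = n'" "length (filter (\<lambda>p. slope p = -1) ps') = f'"
    using assms unfolding realizable_def by blast
  then show ?thesis
    unfolding realizable_def
    by (intro exI[of _ "m + m'"] exI[of _ "ps @ map (shift m) ps'"])
      (simp add: gadget_append filter_map o_def)
qed

lemma realizableI:
  assumes "gadget m ps" "length ps = n" "length (filter (\<lambda>p. slope p = -1) ps) = f"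
  shows "realizable n f"
  using assms unfolding realizable_def by blast

text \<open>Block \<open>i\<close> is \<open>[i, i + 1]\<close>, and \<open>i'\<close> means that it
  is traversed reversed. Itinerary 0, 1', 2: block 1 is reflected in place.\<close>

lemma realizable_2_2: "realizable 2 2"
proof (rule realizableI)
  show "gadget 2 [Piece 0 1 (-1) 2, Piece 1 2 (-1) 4]"
    by (rule gadgetI[where rs = "[(-1, 2), (1, 2)]"]) (auto simp: gadget_simps)
qed simp_all

text \<open>Itinerary 0, 1', 2', 3: the step between the two reversed blocks preserves
  orientation.\<close>

lemma realizable_3_2: "realizable 3 2"
proof (rule realizableI)
  show "gadget 3 [Piece 0 1 (-1) 2, Piece 1 2 1 1, Piece 2 3 (-1) 6]"
    by (rule gadgetI[where rs = "[(-1, 2), (-1, 3), (1, 3)]"]) (auto simp: gadget_simps)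
qed simp_all

text \<open>Itinerary 0, 2, 1, 3: blocks 1 and 2 are swapped, and the steps from 0 to 2 and from 1
  to 3 merge into one piece.\<close>

lemma realizable_2_0: "realizable 2 0"
proof (rule realizableI)
  show "gadget 3 [Piece 0 2 1 2, Piece 2 3 1 (-1)]"
    by (rule gadgetI[where rs = "[(1, 2), (1, 1), (1, 3)]"]) (auto simp: gadget_simps)
qed simp_all

text \<open>Itinerary 0, 2, 3', 1', 4: the reversing steps from 2 to 3' and from 1' to 4 merge into
  one flip of length two.\<close>

lemma realizable_3_1: "realizable 3 1"
proof (rule realizableI)
  show "gadget 4 [Piece 0 1 1 2, Piece 1 3 (-1) 6, Piece 3 4 1 (-2)]"
    by (rule gadgetI[where rs = "[(1, 2), (-1, 4), (-1, 2), (1, 4)]"]) (auto simp: gadget_simps)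
qed simp_all

text \<open>Itinerary 0, 2', 3, 1', 4: every step reverses, and those out of blocks 1 and 2
  merge.\<close>

lemma realizable_3_3: "realizable 3 3"
proof (rule realizableI)
  show "gadget 4 [Piece 0 1 (-1) 3, Piece 1 3 (-1) 6, Piece 3 4 (-1) 5]"
    by (rule gadgetI[where rs = "[(-1, 3), (1, 3), (-1, 2), (1, 4)]"]) (auto simp: gadget_simps)
qed simp_all

text \<open>Itinerary 0, 1', 3, 4', 2', 5: only the step from 4' to 2' preserves orientation; the
  steps out of blocks 2 and 3 merge.\<close>

lemma realizable_4_3: "realizable 4 3"
proof (rule realizableI)
  show "gadget 5 [Piece 0 1 (-1) 2, Piece 1 2 (-1) 5, Piece 2 4 (-1) 8, Piece 4 5 1 (-2)]"
    by (rule gadgetI[where rs = "[(-1, 2), (1, 3), (-1, 5), (-1, 3), (1, 5)]"]) (auto simp: gadget_simps)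
qed simp_all

text \<open>Itinerary 0, 2, 4', 3', 1', 5: the steps out of blocks 1 and 2 merge into the only
  flip.\<close>

lemma realizable_4_1: "realizable 4 1"
proof (rule realizableI)
  show "gadget 5 [Piece 0 1 1 2, Piece 1 3 (-1) 7, Piece 3 4 1 (-2), Piece 4 5 1 (-1)]"
    by (rule gadgetI[where rs = "[(1, 2), (-1, 5), (-1, 4), (-1, 2), (1, 5)]"]) (auto simp: gadget_simps)
qed simp_all

section \<open>Orbits of an irrational rotation\<close>

definition dense_on :: "real set \<Rightarrow> real \<Rightarrow> real \<Rightarrow> bool" where
  "dense_on X a b \<longleftrightarrow> (\<forall>u v. a \<le> u \<and> u < v \<and> v \<le> b \<longrightarrow> (\<exists>y\<in>X. u < y \<and> y < v))"

lemma dense_onD: "dense_on X a b \<Longrightarrow> a \<le> u \<Longrightarrow> u < v \<Longrightarrow> v \<le> b \<Longrightarrow> \<exists>y\<in>X. u < y \<and> y < v"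
  by (simp add: dense_on_def)

lemma dense_on_join:
  assumes "dense_on X a b" "dense_on X b c"
  shows "dense_on X a c"
  unfolding dense_on_def
proof (intro allI impI)
  fix u v assume uv: "a \<le> u \<and> u < v \<and> v \<le> c"
  show "\<exists>y\<in>X. u < y \<and> y < v"
  proof (cases "u < b")
    case True
    then show ?thesis using dense_onD[OF assms(1), of u "min v b"] uv by auto
  next
    case False
    then show ?thesis using dense_onD[OF assms(2), of u v] uv by auto
  qed
qed

lemma dense_on_mono: "dense_on X a b \<Longrightarrow> X \<subseteq> Y \<Longrightarrow> dense_on Y a b"
  unfolding dense_on_def by (meson subset_iff)

lemma dense_on_subinterval: "dense_on X a b \<Longrightarrow> a \<le> c \<Longrightarrow> d \<le> b \<Longrightarrow> dense_on X c d"
  unfolding dense_on_def by (meson order_trans)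

lemma dense_on_translate:
  assumes "dense_on X a b" "\<And>y. y \<in> X \<Longrightarrow> a < y \<Longrightarrow> y < b \<Longrightarrow> c + y \<in> X"
  shows "dense_on X (c + a) (c + b)"
  unfolding dense_on_def
proof (intro allI impI)
  fix u v assume uv: "c + a \<le> u \<and> u < v \<and> v \<le> c + b"
  obtain y where "y \<in> X" "u - c < y" "y < v - c"
    using dense_onD[OF assms(1), of "u - c" "v - c"] uv by auto
  then show "\<exists>y\<in>X. u < y \<and> y < v"
    using assms(2)[of y] uv by (intro bexI[of _ "c + y"]) auto
qed

lemma dense_on_reflect:
  assumes "dense_on X a b" "\<And>y. y \<in> X \<Longrightarrow> a < y \<Longrightarrow> y < b \<Longrightarrow> c - y \<in> X"
  shows "dense_on X (c - b) (c - a)"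
  unfolding dense_on_def
proof (intro allI impI)
  fix u v assume uv: "c - b \<le> u \<and> u < v \<and> v \<le> c - a"
  obtain y where "y \<in> X" "c - v < y" "y < c - u"
    using dense_onD[OF assms(1), of "c - v" "c - u"] uv by auto
  then show "\<exists>y\<in>X. u < y \<and> y < v"
    using assms(2)[of y] uv by (intro bexI[of _ "c - y"]) auto
qed

lemma dense_on_blocks:
  assumes "\<And>i. i < m \<Longrightarrow> dense_on X (real i) (real i + 1)"
  shows "dense_on X 0 (real m)"
  using assms
proof (induction m)
  case 0
  then show ?case by (auto simp: dense_on_def)
next
  case (Suc m)
  have "dense_on X 0 (real m)" using Suc by simp
  moreover have "dense_on X (real m) (real m + 1)" using Suc.prems by simp
  ultimately show ?case using dense_on_join by (metis of_nat_Suc add.commute)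
qed

text \<open>Density of the fractional parts of multiples of \<open>1 / \<Lambda>\<close>, rescaled
  by \<open>\<Lambda>\<close>; that form of the theorem provides a positive \<open>k\<close>, hence
  the forward orbit of \<open>1 / 2\<close>.\<close>

lemma dense_half_multiples:
  fixes \<Lambda> :: real
  assumes "\<Lambda> \<notin> \<rat>" "0 < \<Lambda>" "u < v"
  obtains k :: nat and j :: int
  where "u < 1 / 2 + real k - real_of_int j * \<Lambda>" "1 / 2 + real k - real_of_int j * \<Lambda> < v"
proof -
  have "1 / \<Lambda> \<notin> \<rat>"
  proof
    assume "1 / \<Lambda> \<in> \<rat>"
    then have "inverse (1 / \<Lambda>) \<in> \<rat>" by (rule Rats_inverse)
    then show False using assms(1) by simp
  qed
  moreover have "(v - u) / 2 / \<Lambda> > 0" using assms by simp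
  ultimately obtain h k :: int where hk: "k > 0"
      "\<bar>of_int k * (1 / \<Lambda>) - of_int h - ((u + v) / 2 - 1 / 2) / \<Lambda>\<bar> < (v - u) / 2 / \<Lambda>"
    by (rule sequence_of_fractional_parts_is_dense)
  have "of_int k * (1 / \<Lambda>) - of_int h - ((u + v) / 2 - 1 / 2) / \<Lambda> =
      (of_int k - of_int h * \<Lambda> - ((u + v) / 2 - 1 / 2)) / \<Lambda>"
    using assms(2) by (simp add: field_simps)
  then have "\<bar>of_int k - of_int h * \<Lambda> - ((u + v) / 2 - 1 / 2)\<bar> / \<Lambda> < (v - u) / 2 / \<Lambda>"
    using hk(2) assms(2) by (simp add: abs_divide)
  then have "\<bar>of_int k - of_int h * \<Lambda> - ((u + v) / 2 - 1 / 2)\<bar> < (v - u) / 2"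
    using assms(2) by (metis divide_less_cancel order_less_asym)
  then have "u < 1 / 2 + k - h * \<Lambda>" "1 / 2 + k - h * \<Lambda> < v"
    by (auto simp: abs_less_iff field_simps)
  then show ?thesis
    using that[of "nat k" h] hk(1) by simp
qed

text \<open>The starting point \<open>1 / 2\<close> keeps the orbit off the block endpoints: an
  integer value contradicts parity if \<open>j = 0\<close> and irrationality otherwise.\<close>

lemma half_multiple_not_Int:
  assumes "\<Lambda> \<notin> \<rat>"
  shows "1 / 2 + real k - real_of_int j * \<Lambda> \<notin> \<int>"
proof
  assume "1 / 2 + real k - real_of_int j * \<Lambda> \<in> \<int>"
  then obtain i :: int where i: "1 / 2 + real k - real_of_int j * \<Lambda> = i" by (elim Ints_cases)
  show False
  proof (cases "j = 0")
    case True
    then have "real_of_int (1 + 2 * int k) = real_of_int (2 * i)" using i by simp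
    then have "1 + 2 * int k = 2 * i" by (simp only: of_int_eq_iff)
    then show False by presburger
  next
    case False
    then have "\<Lambda> = (1 / 2 + real k - i) / j" using i by (simp add: field_simps)
    then have "\<Lambda> \<in> \<rat>" by simp
    then show False using assms by simp
  qed
qed

text \<open>The base rotation is \<open>y \<mapsto> y + 1\<close> modulo \<open>\<Lambda>\<close>; its orbit of \<open>1 / 2\<close> is followed
  outside \<open>[1, m]\<close>, which is crossed in one go by \<open>skip\<close>.\<close>

lemma rotation_walk:
  fixes \<Lambda> :: real and m :: nat
  assumes \<Lambda>: "\<Lambda> \<notin> \<rat>" "real m + 1 < \<Lambda>"
    and skip: "\<And>u. 0 < u \<Longrightarrow> u < 1 \<Longrightarrow> r\<^sup>*\<^sup>* u (real m + u)"
    and forward: "\<And>y. real m < y \<Longrightarrow> y < \<Lambda> - 1 \<Longrightarrow> y \<notin> \<int> \<Longrightarrow> r\<^sup>*\<^sup>* y (y + 1)"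
    and return: "\<And>y. \<Lambda> - 1 < y \<Longrightarrow> y < \<Lambda> \<Longrightarrow> y \<notin> \<int> \<Longrightarrow> r\<^sup>*\<^sup>* y (y + 1 - \<Lambda>)"
    and y: "y = 1 / 2 + real k - real_of_int j * \<Lambda>" "0 < y \<and> y < 1 \<or> real m < y \<and> y < \<Lambda>"
  shows "r\<^sup>*\<^sup>* (1 / 2) y"
  using y
proof (induction k arbitrary: j y rule: less_induct)
  case (less k)
  have y_notInt: "y \<notin> \<int>"
    using half_multiple_not_Int[OF \<Lambda>(1)] less.prems(1) by simp
  \<comment> \<open>As long as \<open>1 / 2 + k\<close> is below \<open>\<Lambda>\<close> the
    rotation has not wrapped around.\<close>
  have j0: "j = 0" if "0 < y" "y < \<Lambda>" "0 < 1 / 2 + real k" "1 / 2 + real k < \<Lambda>"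
  proof -
    have "\<bar>real_of_int j * \<Lambda>\<bar> < \<Lambda>" using that less.prems(1) by linarith
    then have "\<bar>real_of_int j\<bar> * \<Lambda> < 1 * \<Lambda>" using that(1,2) by (simp add: abs_mult)
    moreover have "0 < \<Lambda>" using that(1,2) by linarith
    ultimately have "\<bar>real_of_int j\<bar> < 1" using mult_less_cancel_right_pos by blast
    then show ?thesis by linarith
  qed
  have pos: "0 < y" "y < \<Lambda>" using less.prems(2) \<Lambda>(2) by auto
  \<comment> \<open>Sorted by the rule that leads into \<open>y\<close>: \<open>return\<close>,
    \<open>skip\<close> or \<open>forward\<close>. In the second case \<open>1 <= y\<close> excludes
    \<open>m = 0\<close>, so undoing the skip really decreases \<open>k\<close>.\<close>
  consider "0 < y" "y < 1" | "real m < y" "y < real m + 1" "1 \<le> y" | "real m + 1 < y" "y < \<Lambda>"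
  proof -
    have "y \<noteq> real m + 1" using y_notInt Ints_of_nat[of "m + 1"] by auto
    then show thesis
      using that less.prems(2) by (cases "y < 1"; cases "y < real m + 1") auto
  qed
  then show ?case
  proof cases
    case 1
    show ?thesis
    proof (cases k)
      case 0
      then have "j = 0" using j0 pos \<Lambda>(2) by simp
      then have "y = 1 / 2" using less.prems(1) 0 by simp
      show ?thesis unfolding \<open>y = 1 / 2\<close> ..
    next
      case (Suc k')
      have eq: "y - 1 + \<Lambda> = 1 / 2 + real k' - real_of_int (j - 1) * \<Lambda>"
        using less.prems(1) Suc by (simp add: algebra_simps)
      have "r\<^sup>*\<^sup>* (1 / 2) (y - 1 + \<Lambda>)"
        using less.IH[OF _ eq] Suc 1 \<Lambda>(2) by simp
      moreover have "r\<^sup>*\<^sup>* (y - 1 + \<Lambda>) (y - 1 + \<Lambda> + 1 - \<Lambda>)"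
        using half_multiple_not_Int[OF \<Lambda>(1), of k' "j - 1"] 1 unfolding eq[symmetric]
        by (intro return) auto
      ultimately show ?thesis by simp
    qed
  next
    case 2
    have "m \<le> k"
    proof (rule ccontr)
      assume "\<not> m \<le> k"
      then have "real k + 1 \<le> real m" by simp
      then have "j = 0" using j0 pos \<Lambda>(2) by simp
      then show False using less.prems(1) 2 \<open>real k + 1 \<le> real m\<close> by simp
    qed
    have m0: "m \<noteq> 0" using 2 by auto
    have eq: "y - real m = 1 / 2 + real (k - m) - real_of_int j * \<Lambda>"
      using less.prems(1) \<open>m \<le> k\<close> by (simp add: of_nat_diff)
    have "r\<^sup>*\<^sup>* (1 / 2) (y - real m)"
      using less.IH[OF _ eq] m0 \<open>m \<le> k\<close> 2 by simp
    moreover have "r\<^sup>*\<^sup>* (y - real m) (real m + (y - real m))"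
      using 2 by (intro skip) auto
    ultimately show ?thesis by simp
  next
    case 3
    have "k \<noteq> 0"
    proof
      assume "k = 0"
      then have "j = 0" using j0 pos \<Lambda>(2) by simp
      then show False using less.prems(1) 3 \<open>k = 0\<close> by simp
    qed
    then obtain k' where k': "k = Suc k'" by (cases k) auto
    have eq: "y - 1 = 1 / 2 + real k' - real_of_int j * \<Lambda>"
      using less.prems(1) k' by simp
    have "r\<^sup>*\<^sup>* (1 / 2) (y - 1)"
      using less.IH[OF _ eq] k' 3 by simp
    moreover have "r\<^sup>*\<^sup>* (y - 1) (y - 1 + 1)"
      using half_multiple_not_Int[OF \<Lambda>(1), of k' j] 3 unfolding eq[symmetric]
      by (intro forward) auto
    ultimately show ?thesis by simp
  qed
qed

text \<open>Nothing is claimed on \<open>[1, m]\<close>, where the gadget permutes the orbit; that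
  part is recovered by \<open>gadget_dense\<close>.\<close>

lemma rotation_dense:
  fixes \<Lambda> :: real and m :: nat
  assumes \<Lambda>: "\<Lambda> \<notin> \<rat>" "real m + 1 < \<Lambda>"
    and skip: "\<And>u. 0 < u \<Longrightarrow> u < 1 \<Longrightarrow> r\<^sup>*\<^sup>* u (real m + u)"
    and forward: "\<And>y. real m < y \<Longrightarrow> y < \<Lambda> - 1 \<Longrightarrow> y \<notin> \<int> \<Longrightarrow> r\<^sup>*\<^sup>* y (y + 1)"
    and return: "\<And>y. \<Lambda> - 1 < y \<Longrightarrow> y < \<Lambda> \<Longrightarrow> y \<notin> \<int> \<Longrightarrow> r\<^sup>*\<^sup>* y (y + 1 - \<Lambda>)"
  shows "dense_on {y. r\<^sup>*\<^sup>* (1 / 2) y \<and> y \<notin> \<int>} 0 1"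
    and "dense_on {y. r\<^sup>*\<^sup>* (1 / 2) y \<and> y \<notin> \<int>} (real m) \<Lambda>"
proof -
  have *: "\<exists>y\<in>{y. r\<^sup>*\<^sup>* (1 / 2) y \<and> y \<notin> \<int>}. u < y \<and> y < v"
    if uv: "u < v" "0 \<le> u \<and> v \<le> 1 \<or> real m \<le> u \<and> v \<le> \<Lambda>" for u v
  proof -
    obtain k :: nat and j :: int where kj: "u < 1 / 2 + real k - real_of_int j * \<Lambda>"
        "1 / 2 + real k - real_of_int j * \<Lambda> < v"
      using dense_half_multiples[OF \<Lambda>(1) _ uv(1)] \<Lambda>(2) by auto
    have "r\<^sup>*\<^sup>* (1 / 2) (1 / 2 + real k - real_of_int j * \<Lambda>)"
      using kj uv(2) by (intro rotation_walk[OF \<Lambda> skip forward return refl]) auto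
    then show ?thesis using kj half_multiple_not_Int[OF \<Lambda>(1), of k j] by blast
  qed
  show "dense_on {y. r\<^sup>*\<^sup>* (1 / 2) y \<and> y \<notin> \<int>} 0 1"
    unfolding dense_on_def using * by blast
  show "dense_on {y. r\<^sup>*\<^sup>* (1 / 2) y \<and> y \<notin> \<int>} (real m) \<Lambda>"
    unfolding dense_on_def using * by blast
qed

section \<open>Closing up the circle\<close>

definition attainable :: "nat \<Rightarrow> nat \<Rightarrow> bool" where
  "attainable n f \<longleftrightarrow> (\<exists>I T. is_CET n I T \<and> num_flips n I T = f \<and> cet_transitive n I T)"

lemma circ_neq: "x \<noteq> y \<Longrightarrow> \<bar>x - y\<bar> < L \<Longrightarrow> circ L x \<noteq> circ L y"
  using circ_eqD by blast

context piecewise_exchange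
begin

lemma attainable:
  assumes "dense_on {y. moves\<^sup>*\<^sup>* x y} 0 L"
  shows "attainable (length ps) (length (filter (\<lambda>p. slope p = -1) ps))"
proof -
  have "cet_transitive (length ps) arcs exchange"
    by (rule transitive[of x]) (use dense_onD[OF assms] in auto)
  then show ?thesis
    using is_CET num_flips unfolding attainable_def by blast
qed

lemma steps_moves: "(step qs)\<^sup>*\<^sup>* x y \<Longrightarrow> set qs \<subseteq> set ps \<Longrightarrow> moves\<^sup>*\<^sup>* x y"
proof -
  assume *: "(step qs)\<^sup>*\<^sup>* x y" "set qs \<subseteq> set ps"
  have "moves u v" if s: "step qs u v" for u v
  proof -
    obtain p where "p \<in> set qs" "lo p < u" "u < hi p" "v = ap p u"
      using s unfolding step_def by blast
    then have "p \<in> set ps" "lo p < u" "u < hi p" "v = ap p u + of_int 0 * L"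
      using *(2) by auto
    then show ?thesis unfolding moves_def by blast
  qed
  then show "moves\<^sup>*\<^sup>* x y"
    using rtranclp_mono[of "step qs" moves] *(1) by blast
qed

lemma reach_step: "moves\<^sup>*\<^sup>* x y \<Longrightarrow> moves y z \<Longrightarrow> moves\<^sup>*\<^sup>* x z"
  by (rule rtranclp.rtrancl_into_rtrancl)

text \<open>The gadget carries the first block isometrically onto every other one, and density
  travels along.\<close>

lemma gadget_dense:
  assumes g: "gadget m qs" "set qs \<subseteq> set ps"
    and d: "dense_on {y. moves\<^sup>*\<^sup>* x y} 0 1"
  shows "dense_on {y. moves\<^sup>*\<^sup>* x y} 0 (real m)"
proof (rule dense_on_blocks)
  fix i assume i: "i < m"
  from gadgetD(10)[OF g(1) i] show "dense_on {y. moves\<^sup>*\<^sup>* x y} (real i) (real i + 1)"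
  proof
    assume A: "\<forall>u. 0 < u \<and> u < 1 \<longrightarrow> (step qs)\<^sup>*\<^sup>* u (real i + u)"
    have "moves\<^sup>*\<^sup>* x (real i + y)" if "moves\<^sup>*\<^sup>* x y" "0 < y" "y < 1" for y
      using rtranclp_trans[OF that(1) steps_moves[OF A[rule_format, OF conjI[OF that(2,3)]] g(2)]] .
    then show ?thesis
      using dense_on_translate[OF d, of "real i"] by simp
  next
    assume A: "\<forall>u. 0 < u \<and> u < 1 \<longrightarrow> (step qs)\<^sup>*\<^sup>* u (real i + 1 - u)"
    have "moves\<^sup>*\<^sup>* x (real i + 1 - y)" if "moves\<^sup>*\<^sup>* x y" "0 < y" "y < 1" for y
      using rtranclp_trans[OF that(1) steps_moves[OF A[rule_format, OF conjI[OF that(2,3)]] g(2)]] .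
    then show ?thesis
      using dense_on_reflect[OF d, of "real i + 1"] by simp
  qed
qed

end

lemma irrational_length:
  obtains \<Lambda> :: real where "\<Lambda> \<notin> \<rat>" "real m + 3 < \<Lambda>"
proof -
  have "uncountable {real m + 3<..<real m + 4}" by (simp add: uncountable_open_interval)
  then have "\<not> {real m + 3<..<real m + 4} \<subseteq> \<rat>"
    using countable_rat countable_subset by blast
  then obtain \<Lambda> where "\<Lambda> \<in> {real m + 3<..<real m + 4}" "\<Lambda> \<notin> \<rat>" by blast
  then have "\<Lambda> \<notin> \<rat>" "real m + 3 < \<Lambda>" by simp_all
  then show ?thesis by (rule that)
qed

lemma gadget_tiles_mem:
  assumes "gadget m ps" "p \<in> set ps"
  shows "0 \<le> lo p" "lo p < hi p" "hi p \<le> real m"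
  using tiles_mem[OF gadgetD(1)[OF assms(1)] assms(2)] by auto

text \<open>All values lie in \<open>[1, m + 1]\<close>, so distinct ones differ by less than
  \<open>L\<close> and stay distinct on the circle.\<close>

lemma gadget_jumps:
  assumes g: "gadget m ps" and "real m < L"
  shows "successively (\<lambda>p q. circ L (ap p (hi p)) \<noteq> circ L (ap q (lo q))) ps"
  unfolding successively_conv_nth
proof (intro allI impI)
  fix i assume i: "Suc i < length ps"
  have "ap (ps ! i) (hi (ps ! i)) \<noteq> ap (ps ! Suc i) (lo (ps ! Suc i))"
    using gadgetD(5)[OF g] i by (simp add: successively_conv_nth)
  moreover have in_ps: "ps ! i \<in> set ps" "ps ! Suc i \<in> set ps" using i by auto
  ultimately show "circ L (ap (ps ! i) (hi (ps ! i))) \<noteq> circ L (ap (ps ! Suc i) (lo (ps ! Suc i)))"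
    using gadgetD(3)[OF g in_ps(1), of "hi (ps ! i)"] gadgetD(3)[OF g in_ps(2), of "lo (ps ! Suc i)"]
      gadget_tiles_mem[OF g in_ps(1)] gadget_tiles_mem[OF g in_ps(2)] \<open>real m < L\<close>
    by (intro circ_neq) auto
qed

text \<open>The closing piece \<open>q\<close> is the plain rotation on
  \<open>[m, \<Lambda>]\<close>; its image \<open>[m + 1, \<Lambda> + 1]\<close> lies next to the
  values \<open>[1, m + 1]\<close> of the gadget.\<close>

lemma realizable_attainable:
  assumes "realizable n f" "n \<noteq> 0"
  shows "attainable (Suc n) f"
proof -
  obtain m ps where g: "gadget m ps" and n: "length ps = n"
    and f: "length (filter (\<lambda>p. slope p = -1) ps) = f"
    using assms unfolding realizable_def by blast
  have ps: "ps \<noteq> []" using n assms(2) by auto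
  obtain \<Lambda> where \<Lambda>: "\<Lambda> \<notin> \<rat>" "real m + 3 < \<Lambda>" using irrational_length .
  define q where "q = Piece m \<Lambda> 1 1"
  have q: "lo q = m" "hi q = \<Lambda>" "slope q = 1" "\<And>x. ap q x = x + 1"
    by (simp_all add: q_def ap_def)
  note G = gadgetD[OF g]
  interpret piecewise_exchange \<Lambda> 1 "ps @ [q]"
  proof
    show "0 < \<Lambda>" using \<Lambda>(2) by linarith
    show "tiles 0 (ps @ [q]) \<Lambda>"
      using G(1) q \<Lambda>(2) by (auto simp: tiles_append)
    show "rigid p" if "p \<in> set (ps @ [q])" for p
      using that G(2) q by (auto simp: rigid_def)
    show "1 \<le> ap p x \<and> ap p x \<le> 1 + \<Lambda>" if "p \<in> set (ps @ [q])" "lo p \<le> x" "x \<le> hi p" for p x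
    proof (cases "p = q")
      case True
      then show ?thesis using that q by simp
    next
      case False
      then show ?thesis using that G(3)[of p x] \<Lambda>(2) by auto
    qed
    have "disjoint_images p q" if "p \<in> set ps" for p
      unfolding disjoint_images_def q using gadget_interior[OF g that] by force
    then show "sorted_wrt disjoint_images (ps @ [q])"
      using G(4) by (simp add: sorted_wrt_append)
    have "last ps \<in> set ps" using ps by simp
    then have last: "1 \<le> ap (last ps) m" "ap (last ps) m \<le> m"
      using G(3)[of "last ps" m] G(8)[OF ps] tiles_last[OF G(1) ps]
        gadget_tiles_mem[OF g, of "last ps"] by auto
    have "circ \<Lambda> (ap (last ps) (hi (last ps))) \<noteq> circ \<Lambda> (ap q (lo q))"
      using last \<Lambda>(2) tiles_last[OF G(1) ps] q by (intro circ_neq) auto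
    then show "successively (\<lambda>p q. circ \<Lambda> (ap p (hi p)) \<noteq> circ \<Lambda> (ap q (lo q))) (ps @ [q])"
      using gadget_jumps[OF g, of \<Lambda>] \<Lambda>(2) by (simp add: successively_append_iff)
    \<comment> \<open>The left limit \<open>\<Lambda> + 1\<close> is the point 1 of the circle; the
      gadget starts with a value between 2 and \<open>m\<close>.\<close>
    show "circ \<Lambda> (ap (last (ps @ [q])) \<Lambda>) \<noteq> circ \<Lambda> (ap (hd (ps @ [q])) 0)"
      using G(6,7)[OF ps] \<Lambda>(2) q ps by (intro circ_neq) auto
  qed simp
  have move: "moves y (y + 1 + of_int k * \<Lambda>)" if "real m < y" "y < \<Lambda>" for y k
    unfolding moves_def using that q by (intro bexI[of _ q] exI[of _ k]) auto
  have skip: "moves\<^sup>*\<^sup>* u (real m + u)" if "0 < u" "u < 1" for u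
    by (rule steps_moves[OF G(9)[OF that]]) auto
  have fwd: "moves\<^sup>*\<^sup>* y (y + 1)" if "real m < y" "y < \<Lambda> - 1" "y \<notin> \<int>" for y
    using move[of y 0] that by auto
  have ret: "moves\<^sup>*\<^sup>* y (y + 1 - \<Lambda>)" if "\<Lambda> - 1 < y" "y < \<Lambda>" "y \<notin> \<int>" for y
    using move[of y "-1"] that \<Lambda>(2) by auto
  have \<Lambda>1: "real m + 1 < \<Lambda>" using \<Lambda>(2) by simp
  note D = rotation_dense[where r = moves and m = m, OF \<Lambda>(1) \<Lambda>1 skip fwd ret]
  have "dense_on {y. moves\<^sup>*\<^sup>* (1 / 2) y} 0 1" by (rule dense_on_mono[OF D(1)]) auto
  then have "dense_on {y. moves\<^sup>*\<^sup>* (1 / 2) y} 0 m"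
    by (intro gadget_dense[OF g]) auto
  moreover have "dense_on {y. moves\<^sup>*\<^sup>* (1 / 2) y} m \<Lambda>" by (rule dense_on_mono[OF D(2)]) auto
  ultimately have "dense_on {y. moves\<^sup>*\<^sup>* (1 / 2) y} 0 \<Lambda>" by (rule dense_on_join)
  from attainable[OF this] show ?thesis using n f q by simp
qed

text \<open>Replacing the long interval \<open>Q = [m, \<Lambda>]\<close> by a tower of height two, with \<open>Q\<close> mapped
  by a flip onto a copy \<open>[\<Lambda>, L]\<close> and the copy back by a flip, avoids the unflipped piece.\<close>

lemma realizable_attainable_flipped:
  assumes "realizable n f"
  shows "attainable (n + 3) (f + 3)"
proof -
  obtain m ps where g: "gadget m ps" and n: "length ps = n"
    and f: "length (filter (\<lambda>p. slope p = -1) ps) = f"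
    using assms unfolding realizable_def by blast
  obtain \<Lambda> where \<Lambda>: "\<Lambda> \<notin> \<rat>" "real m + 3 < \<Lambda>" using irrational_length .
  define L where "L = 2 * \<Lambda> - m"
  \<comment> \<open>The values of gadget, \<open>c\<close>, \<open>a\<close>, \<open>b\<close>
    occupy \<open>[1, m + 1]\<close>, \<open>[m + 1, \<Lambda>]\<close>,
    \<open>[\<Lambda>, L]\<close>, \<open>[L, L + 1]\<close>. After \<open>a\<close>, piece
    \<open>c\<close> gives \<open>y + 1\<close>, and \<open>b\<close> gives
    \<open>y + 1 - \<Lambda>\<close> modulo \<open>L\<close> when the rotation wraps.\<close>
  define a b c where "a = Piece m \<Lambda> (-1) (2 * \<Lambda>)"
    and "b = Piece \<Lambda> (\<Lambda> + 1) (-1) (L + 1 + \<Lambda>)" and "c = Piece (\<Lambda> + 1) L (-1) (2 * \<Lambda> + 1)"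
  have abc: "lo a = m" "hi a = \<Lambda>" "slope a = -1" "\<And>x. ap a x = 2 * \<Lambda> - x"
    "lo b = \<Lambda>" "hi b = \<Lambda> + 1" "slope b = -1" "\<And>x. ap b x = L + 1 + \<Lambda> - x"
    "lo c = \<Lambda> + 1" "hi c = L" "slope c = -1" "\<And>x. ap c x = 2 * \<Lambda> + 1 - x"
    by (simp_all add: a_def b_def c_def ap_def)
  have L: "L = 2 * \<Lambda> - m" "\<Lambda> + 1 < L" "real m + 3 < L" "0 < L" using \<Lambda>(2) by (auto simp: L_def)
  note G = gadgetD[OF g]
  let ?ps = "ps @ [a, b, c]"
  interpret piecewise_exchange L 1 ?ps
  proof
    show "0 < L" by (fact L)
    show "tiles 0 ?ps L"
      using G(1) abc L \<Lambda>(2) by (auto simp: tiles_append)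
    show "rigid p" if "p \<in> set ?ps" for p
      using that G(2) abc by (auto simp: rigid_def)
    show "1 \<le> ap p x \<and> ap p x \<le> 1 + L" if p: "p \<in> set ?ps" "lo p \<le> x" "x \<le> hi p" for p x
    proof -
      consider "p \<in> set ps" | "p = a" | "p = b" | "p = c" using p(1) by auto
      then show ?thesis
      proof cases
        case 1
        then show ?thesis using G(3)[of p x] p L by auto
      qed (use p abc L \<Lambda>(2) in auto)
    qed
    have "disjoint_images p r" if "p \<in> set ps" "r \<in> {a, b, c}" for p r
      unfolding disjoint_images_def
    proof (intro allI impI)
      fix x y assume xy: "lo p < x \<and> x < hi p \<and> lo r < y \<and> y < hi r"
      then have "ap p x < real m + 1" using gadget_interior[OF g that(1)] by simp
      moreover have "real m + 1 < ap r y" using that(2) xy abc L \<Lambda>(2) by auto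
      ultimately show "ap p x \<noteq> ap r y" by simp
    qed
    moreover have "disjoint_images a b" "disjoint_images a c" "disjoint_images b c"
      using abc L by (auto simp: disjoint_images_def)
    ultimately show "sorted_wrt disjoint_images ?ps"
      using G(4) by (simp add: sorted_wrt_append)
    have "circ L (ap (last ps) (hi (last ps))) \<noteq> circ L (ap a (lo a))" if ps: "ps \<noteq> []"
    proof -
      have "last ps \<in> set ps" using ps by simp
      then have "1 \<le> ap (last ps) m" "ap (last ps) m \<le> m"
        using G(3)[of "last ps" m] G(8)[OF ps] tiles_last[OF G(1) ps]
          gadget_tiles_mem[OF g, of "last ps"] by auto
      then show ?thesis
        using L tiles_last[OF G(1) ps] abc by (intro circ_neq) auto
    qed
    moreover have "circ L (ap a (hi a)) \<noteq> circ L (ap b (lo b))" "circ L (ap b (hi b)) \<noteq> circ L (ap c (lo c))"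
      unfolding abc using L \<Lambda>(2) by (intro circ_neq; simp)+
    moreover have "successively (\<lambda>p q. circ L (ap p (hi p)) \<noteq> circ L (ap q (lo q))) ps"
      by (rule gadget_jumps[OF g]) (use L in simp)
    ultimately show "successively (\<lambda>p q. circ L (ap p (hi p)) \<noteq> circ L (ap q (lo q))) ?ps"
      by (cases "ps = []") (simp_all add: successively_append_iff)
    show "circ L (ap (last ?ps) L) \<noteq> circ L (ap (hd ?ps) 0)"
    proof (cases "ps = []")
      case True
      then have "m = 0" using G(1) by simp
      then have "circ L (2 * \<Lambda> + 1 - L) \<noteq> circ L (2 * \<Lambda> - 0)"
        by (intro circ_neq) (use L \<Lambda>(2) in simp_all)
      moreover have "last ?ps = c" "hd ?ps = a" using True by simp_all
      ultimately show ?thesis by (simp only: abc not_False_eq_True)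
    next
      case False
      have "circ L (2 * \<Lambda> + 1 - L) \<noteq> circ L (ap (hd ps) 0)"
        by (intro circ_neq) (use L \<Lambda>(2) G(6,7)[OF False] in simp_all)
      moreover have "last ?ps = c" "hd ?ps = hd ps" using False by simp_all
      ultimately show ?thesis by (simp only: abc not_False_eq_True)
    qed
  qed simp
  have up: "moves y (2 * \<Lambda> - y)" if "real m < y" "y < \<Lambda>" for y
    unfolding moves_def using that abc by (intro bexI[of _ a] exI[of _ 0]) auto
  have skip: "moves\<^sup>*\<^sup>* u (real m + u)" if "0 < u" "u < 1" for u
    by (rule steps_moves[OF G(9)[OF that]]) auto
  have fwd: "moves\<^sup>*\<^sup>* y (y + 1)" if y: "real m < y" "y < \<Lambda> - 1" "y \<notin> \<int>" for y
  proof -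
    have "moves (2 * \<Lambda> - y) (y + 1)"
      unfolding moves_def using y abc L by (intro bexI[of _ c] exI[of _ 0]) auto
    moreover have "moves y (2 * \<Lambda> - y)" using up[of y] y by simp
    ultimately show ?thesis by (meson converse_rtranclp_into_rtranclp r_into_rtranclp)
  qed
  have ret: "moves\<^sup>*\<^sup>* y (y + 1 - \<Lambda>)" if y: "\<Lambda> - 1 < y" "y < \<Lambda>" "y \<notin> \<int>" for y
  proof -
    have "moves (2 * \<Lambda> - y) (y + 1 - \<Lambda>)"
      unfolding moves_def using y abc L by (intro bexI[of _ b] exI[of _ "-1"]) auto
    moreover have "moves y (2 * \<Lambda> - y)" using up[of y] y \<Lambda>(2) by simp
    ultimately show ?thesis by (meson converse_rtranclp_into_rtranclp r_into_rtranclp)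
  qed
  have \<Lambda>1: "real m + 1 < \<Lambda>" using \<Lambda>(2) by simp
  note D = rotation_dense[where r = moves and m = m, OF \<Lambda>(1) \<Lambda>1 skip fwd ret]
  let ?X = "{y. moves\<^sup>*\<^sup>* (1 / 2) y}"
  have "dense_on ?X 0 1" by (rule dense_on_mono[OF D(1)]) auto
  then have "dense_on ?X 0 m"
    by (intro gadget_dense[OF g]) auto
  moreover have Q: "dense_on ?X m \<Lambda>" by (rule dense_on_mono[OF D(2)]) auto
  ultimately have lower: "dense_on ?X 0 \<Lambda>" by (rule dense_on_join)
  have "dense_on ?X (2 * \<Lambda> - \<Lambda>) (2 * \<Lambda> - m)"
  proof (rule dense_on_reflect[OF Q])
    fix y assume "y \<in> ?X" "real m < y" "y < \<Lambda>"
    then show "2 * \<Lambda> - y \<in> ?X" using reach_step[OF _ up[of y]] by simp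
  qed
  then have "dense_on ?X \<Lambda> L" unfolding L(1) by simp
  with lower have "dense_on ?X 0 L" by (rule dense_on_join)
  moreover have "length ?ps = n + 3" "length (filter (\<lambda>p. slope p = -1) ?ps) = f + 3"
    using n f abc by simp_all
  ultimately show ?thesis using attainable by metis
qed

text \<open>Doubling the whole circle of length \<open>\<Lambda>\<close>. The way up is cut at 1
  into two reflections onto the copy; on the way down \<open>c\<close> has length 2 because it
  receives both the first block and the points that wrap around.\<close>

lemma attainable_4_4: "attainable 4 4"
proof -
  obtain \<Lambda> where \<Lambda>: "\<Lambda> \<notin> \<rat>" "real 0 + 3 < \<Lambda>" using irrational_length .
  define L where "L = 2 * \<Lambda>"
  define a b c d where "a = Piece 0 1 (-1) (\<Lambda> + 1)" and "b = Piece 1 \<Lambda> (-1) (2 * \<Lambda> + 1)"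
    and "c = Piece \<Lambda> (\<Lambda> + 2) (-1) (\<Lambda> + 2)" and "d = Piece (\<Lambda> + 2) L (-1) (2 * \<Lambda> + 2)"
  have abcd: "lo a = 0" "hi a = 1" "slope a = -1" "\<And>x. ap a x = \<Lambda> + 1 - x"
    "lo b = 1" "hi b = \<Lambda>" "slope b = -1" "\<And>x. ap b x = 2 * \<Lambda> + 1 - x"
    "lo c = \<Lambda>" "hi c = \<Lambda> + 2" "slope c = -1" "\<And>x. ap c x = \<Lambda> + 2 - x"
    "lo d = \<Lambda> + 2" "hi d = L" "slope d = -1" "\<And>x. ap d x = 2 * \<Lambda> + 2 - x"
    by (simp_all add: a_def b_def c_def d_def ap_def)
  have L: "L = 2 * \<Lambda>" "0 < L" "3 < \<Lambda>" using \<Lambda>(2) by (auto simp: L_def)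
  let ?ps = "[a, b, c, d]"
  interpret piecewise_exchange L 0 ?ps
  proof
    show "0 < L" by (fact L)
    show "tiles 0 ?ps L" using abcd L by simp
    show "rigid p" if "p \<in> set ?ps" for p using that abcd by (auto simp: rigid_def)
    show "0 \<le> ap p x \<and> ap p x \<le> 0 + L" if "p \<in> set ?ps" "lo p \<le> x" "x \<le> hi p" for p x
      using that abcd L by auto
    show "sorted_wrt disjoint_images ?ps" using abcd L by (auto simp: disjoint_images_def)
    have "circ L (\<Lambda> + 1 - 1) \<noteq> circ L (2 * \<Lambda> + 1 - 1)"
      "circ L (2 * \<Lambda> + 1 - \<Lambda>) \<noteq> circ L (\<Lambda> + 2 - \<Lambda>)"
      "circ L (\<Lambda> + 2 - (\<Lambda> + 2)) \<noteq> circ L (2 * \<Lambda> + 2 - (\<Lambda> + 2))"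
      "circ L (2 * \<Lambda> + 2 - L) \<noteq> circ L (\<Lambda> + 1 - 0)"
      by (intro circ_neq; use L in simp)+
    note jumps = this
    show "successively (\<lambda>p q. circ L (ap p (hi p)) \<noteq> circ L (ap q (lo q))) ?ps"
      using jumps(1-3) by (simp only: successively.simps abcd simp_thms)
    show "circ L (ap (last ?ps) L) \<noteq> circ L (ap (hd ?ps) 0)"
      using jumps(4) by (simp add: abcd)
  qed simp
  have up0: "moves y (\<Lambda> + 1 - y)" if "0 < y" "y < 1" for y
    unfolding moves_def using that abcd by (intro bexI[of _ a] exI[of _ 0]) auto
  have up1: "moves y (2 * \<Lambda> + 1 - y)" if "1 < y" "y < \<Lambda>" for y
    unfolding moves_def using that abcd by (intro bexI[of _ b] exI[of _ 0]) auto
  have down0: "moves y (\<Lambda> + 2 - y)" if "\<Lambda> < y" "y < \<Lambda> + 2" for y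
    unfolding moves_def using that abcd by (intro bexI[of _ c] exI[of _ 0]) auto
  have down1: "moves y (2 * \<Lambda> + 2 - y)" if "\<Lambda> + 2 < y" "y < 2 * \<Lambda>" for y
    unfolding moves_def using that abcd L by (intro bexI[of _ d] exI[of _ 0]) auto
  have two: "moves\<^sup>*\<^sup>* x z" if "moves x y" "moves y z" for x y z
    using that by (meson converse_rtranclp_into_rtranclp r_into_rtranclp)
  have fwd: "moves\<^sup>*\<^sup>* y (y + 1)" if y: "real 0 < y" "y < \<Lambda> - 1" "y \<notin> \<int>" for y
  proof (cases "y < 1")
    case True
    then show ?thesis using two[OF up0[of y] down0[of "\<Lambda> + 1 - y"]] y by (simp add: add.commute)
  next
    case False
    moreover have "y \<noteq> 1" using y(3) by auto
    ultimately show ?thesis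
      using two[OF up1[of y] down1[of "2 * \<Lambda> + 1 - y"]] y by (simp add: add.commute)
  qed
  have ret: "moves\<^sup>*\<^sup>* y (y + 1 - \<Lambda>)" if y: "\<Lambda> - 1 < y" "y < \<Lambda>" "y \<notin> \<int>" for y
    using two[OF up1[of y] down0[of "2 * \<Lambda> + 1 - y"]] y L(3) by (simp add: algebra_simps)
  have skip: "moves\<^sup>*\<^sup>* u (real 0 + u)" for u by simp
  have \<Lambda>1: "real 0 + 1 < \<Lambda>" using L by simp
  let ?X = "{y. moves\<^sup>*\<^sup>* (1 / 2) y}"
  have "dense_on {y. moves\<^sup>*\<^sup>* (1 / 2) y \<and> y \<notin> \<int>} (real 0) \<Lambda>"
    by (rule rotation_dense[where r = moves, OF \<Lambda>(1) \<Lambda>1 skip fwd ret])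
  then have "dense_on ?X (real 0) \<Lambda>" by (rule dense_on_mono) auto
  then have Q: "dense_on ?X 0 \<Lambda>" by simp
  have Q0: "dense_on ?X 0 1" and Q1: "dense_on ?X 1 \<Lambda>"
    by (rule dense_on_subinterval[OF Q]; use L in simp)+
  have "dense_on ?X (\<Lambda> + 1 - 1) (\<Lambda> + 1 - 0)"
  proof (rule dense_on_reflect[OF Q0])
    fix y assume "y \<in> ?X" "0 < y" "y < 1"
    then show "\<Lambda> + 1 - y \<in> ?X" using reach_step[OF _ up0[of y]] by simp
  qed
  moreover have "dense_on ?X (2 * \<Lambda> + 1 - \<Lambda>) (2 * \<Lambda> + 1 - 1)"
  proof (rule dense_on_reflect[OF Q1])
    fix y assume "y \<in> ?X" "1 < y" "y < \<Lambda>"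
    then show "2 * \<Lambda> + 1 - y \<in> ?X" using reach_step[OF _ up1[of y]] by simp
  qed
  ultimately have "dense_on ?X \<Lambda> (\<Lambda> + 1)" "dense_on ?X (\<Lambda> + 1) (2 * \<Lambda>)" by simp_all
  then have "dense_on ?X \<Lambda> (2 * \<Lambda>)" by (rule dense_on_join)
  with Q have "dense_on ?X 0 L" unfolding L(1) by (rule dense_on_join)
  moreover have "length ?ps = 4" "length (filter (\<lambda>p. slope p = -1) ?ps) = 4"
    using abcd by simp_all
  ultimately show ?thesis using attainable by metis
qed

section \<open>Which pairs are sums of basic gadgets\<close>

lemma realizable_extend:
  assumes "realizable n f" "n' = n + 2 * k + 2 * j" "f' = f + 2 * k"
  shows "realizable n' f'"
proof -
  have F: "realizable (2 * k) (2 * k)"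
  proof (induction k)
    case (Suc k)
    then show ?case using realizable_add[OF realizable_2_2 Suc.IH] by simp
  qed (simp add: realizable_0)
  have S: "realizable (2 * j) 0"
  proof (induction j)
    case (Suc j)
    then show ?case using realizable_add[OF realizable_2_0 Suc.IH] by simp
  qed (simp add: realizable_0)
  show ?thesis
    using realizable_add[OF realizable_add[OF assms(1) F] S] unfolding assms(2,3) by simp
qed

text \<open>With \<open>f = 2 * k + e\<close> and \<open>n - f = 2 * j + r\<close>, the parities
  \<open>e\<close> and \<open>r\<close> select the base gadget, and copies of (2,2) and (2,0) supply
  the rest. For \<open>f = 1\<close> the bound gives \<open>n - f >= 2\<close>, which pays for the
  larger bases (3,1) and (4,1).\<close>

lemma realizable_if:
  assumes "1 \<le> f" "f \<le> n" "4 \<le> n + f"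
  shows "realizable n f"
proof -
  obtain d where d: "n = f + d" using assms(2) le_Suc_ex by blast
  define e k j r where "e = f mod 2" and "k = f div 2" and "j = d div 2" and "r = d mod 2"
  have f: "f = 2 * k + e" and d2: "d = 2 * j + r" by (simp_all add: e_def k_def j_def r_def)
  have er: "e = 0 \<or> e = 1" "r = 0 \<or> r = 1" by (auto simp: e_def r_def)
  show ?thesis
  proof (cases k)
    case k: 0
    then have "f = 1" using f er assms(1) by auto
    moreover obtain j' where j': "j = Suc j'"
      using d d2 er assms(3) \<open>f = 1\<close> by (cases j) auto
    ultimately show ?thesis
      using er(2)
    proof (elim disjE)
      assume "r = 0"
      show ?thesis
        by (rule realizable_extend[OF realizable_3_1, of _ 0 j'])
          (simp_all add: d d2 \<open>f = 1\<close> j' \<open>r = 0\<close>)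
    next
      assume "r = 1"
      show ?thesis
        by (rule realizable_extend[OF realizable_4_1, of _ 0 j'])
          (simp_all add: d d2 \<open>f = 1\<close> j' \<open>r = 1\<close>)
    qed
  next
    case k: (Suc k')
    consider "e = 0" "r = 0" | "e = 0" "r = 1" | "e = 1" "r = 0" | "e = 1" "r = 1"
      using er by blast
    then show ?thesis
    proof cases
      case 1
      show ?thesis
        by (rule realizable_extend[OF realizable_2_2, of _ k' j]) (simp_all add: d d2 f k 1)
    next
      case 2
      show ?thesis
        by (rule realizable_extend[OF realizable_3_2, of _ k' j]) (simp_all add: d d2 f k 2)
    next
      case 3
      show ?thesis
        by (rule realizable_extend[OF realizable_3_3, of _ k' j]) (simp_all add: d d2 f k 3)
    next
      case 4
      show ?thesis
        by (rule realizable_extend[OF realizable_4_3, of _ k' j]) (simp_all add: d d2 f k 4)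
    qed
  qed
qed

text \<open>If \<open>f < n\<close>, one unflipped piece closes a gadget with \<open>n - 1\<close>
  pieces. If \<open>f = n\<close>, a fully flipped gadget with \<open>n - 3\<close> pieces is
  doubled; it is a sum of (2,2) and at most one (3,3), except for \<open>n = 4\<close>.\<close>

lemma attainable_if:
  assumes "1 \<le> f" "f \<le> n" "5 \<le> n + f"
  shows "attainable n f"
proof (cases "f = n")
  case True
  define e k where "e = (n - 3) mod 2" and "k = (n - 3) div 2"
  have n: "n = 2 * k + e + 3" "e = 0 \<or> e = 1" using assms True by (auto simp: e_def k_def)
  consider "e = 0" | "e = 1" "k = 0" | k' where "e = 1" "k = Suc k'"
    using n(2) by (cases k) auto
  then show ?thesis
  proof cases
    case 1
    have "realizable (2 * k) (2 * k)"
      by (rule realizable_extend[OF realizable_0, of _ k 0]) simp_all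
    from realizable_attainable_flipped[OF this] show ?thesis unfolding True n(1) 1 by simp
  next
    case 2
    then have "n = 4" using n(1) by simp
    then show ?thesis unfolding True using attainable_4_4 by simp
  next
    case 3
    have "realizable (3 + 2 * k') (3 + 2 * k')"
      by (rule realizable_extend[OF realizable_3_3, of _ k' 0]) simp_all
    from realizable_attainable_flipped[OF this] show ?thesis
      unfolding True n(1) 3 by (simp add: add.commute)
  qed
next
  case False
  then obtain a where a: "n = Suc a" "f \<le> a" using assms(2) by (cases n) auto
  then have "realizable a f" using assms by (intro realizable_if) auto
  from realizable_attainable[OF this] show ?thesis using a assms(1) by simp
qed

theorem theoremA:
  fixes n f :: nat
  assumes "1 \<le> f" and "f \<le> n"
  shows "(\<exists>I T. is_CET n I T \<and> num_flips n I T = f \<and> cet_transitive n I T) \<longleftrightarrow> n + f \<ge> 5"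
proof
  assume "\<exists>I T. is_CET n I T \<and> num_flips n I T = f \<and> cet_transitive n I T"
  then obtain I T where IT: "is_CET n I T" "num_flips n I T = f" "cet_transitive n I T" by blast
  show "n + f \<ge> 5"
  proof (rule ccontr)
    assume "\<not> n + f \<ge> 5"
    then show False using few_pieces_not_transitive[OF IT(1)] IT(2,3) assms(1) by simp
  qed
next
  assume "n + f \<ge> 5"
  then show "\<exists>I T. is_CET n I T \<and> num_flips n I T = f \<and> cet_transitive n I T"
    using attainable_if[OF assms] by (simp add: attainable_def)
qed

end
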